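(* Let $s \geq 3$ and $t > s!$ be integers. Then there is a constant $C>0$ depending only on $s$ such that for all sufficiently large $n$, \[ \mathrm{rex}(n, K_{s,t}) \geq C n^{2-1/s}. \]
   Context: All graphs are finite and simple. For a graph $F$, $\mathrm{rex}(n,F)$ denotes the maximum number of edges in an $n$-vertex graph that is regular and contains no subgraph isomorphic to $F$. $K_{s,t}$ is the complete bipartite graph with parts of sizes $s$ and $t$. *)

theory Defs
  imports "HOL-Analysis.Analysis" "Graph_Theory.Graph_Theory"
begin

text \<open>
  Finite simple graphs are represented as in the entry \<open>Graph_Theory\<close>: \<^locale>\<open>pair_graph\<close> describes
  a finite, loop-free digraph without parallel arcs whose arc relation is symmetric. Every undirected
  edge is thus present as two opposite arcs, and edges have to be counted as unordered pairs.
\<close>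

definition edge_set :: "'a pair_pre_digraph \<Rightarrow> 'a set set" where
  "edge_set G = (\<lambda>(u, v). {u, v}) ` parcs G"

text \<open>In a symmetric digraph the out-degree of a vertex is its number of neighbours.\<close>

definition regular_graph :: "'a pair_pre_digraph \<Rightarrow> bool" where
  "regular_graph G \<longleftrightarrow> (\<exists>d. \<forall>v\<in>pverts G. out_degree (with_proj G) v = d)"

text \<open>The subgraph isomorphic to \<open>F\<close> need not be induced.\<close>

definition contains_copy :: "'a pair_pre_digraph \<Rightarrow> 'b pair_pre_digraph \<Rightarrow> bool" where
  "contains_copy G F \<longleftrightarrow>
     (\<exists>H. subgraph (with_proj H) (with_proj G) \<and> digraph_iso (with_proj F) (with_proj H))"

text \<open>
  Vertices are taken from \<^typ>\<open>nat\<close>, which is no restriction up to isomorphism. The maximum is over a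
  finite set, which is nonempty if \<open>F\<close> has an edge (see \<open>rex_candidates_nonempty\<close> below); for edgeless
  \<open>F\<close> the value of \<open>rex\<close> can be unspecified.
\<close>

definition rex_candidates :: "nat \<Rightarrow> 'b pair_pre_digraph \<Rightarrow> nat pair_pre_digraph set" where
  "rex_candidates n F =
     {G. pair_graph G \<and> card (pverts G) = n \<and> regular_graph G \<and> \<not> contains_copy G F}"

definition rex :: "nat \<Rightarrow> 'b pair_pre_digraph \<Rightarrow> nat" where
  "rex n F = Max ((\<lambda>G. card (edge_set G)) ` rex_candidates n F)"

definition complete_bipartite :: "nat \<Rightarrow> nat \<Rightarrow> (nat + nat) pair_pre_digraph" where
  "complete_bipartite s t =
     \<lparr> pverts = {..<s} <+> {..<t},
       parcs = Inl ` {..<s} \<times> Inr ` {..<t} \<union> Inr ` {..<t} \<times> Inl ` {..<s} \<rparr>"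

lemma complete_bipartite_digraph_complete_bipartite:
  "complete_bipartite_digraph s t (with_proj (complete_bipartite s t))"
  unfolding complete_bipartite_digraph_pair_def
proof (intro conjI exI)
  show "finite (pverts (complete_bipartite s t))"
    by (simp add: complete_bipartite_def)
  show "pverts (complete_bipartite s t) = Inl ` {..<s} \<union> Inr ` {..<t}"
    by (auto simp: complete_bipartite_def)
  show "parcs (complete_bipartite s t)
      = Inl ` {..<s} \<times> Inr ` {..<t} \<union> Inr ` {..<t} \<times> Inl ` {..<s}"
    by (simp add: complete_bipartite_def)
qed (auto simp: card_image)

lemma finite_rex_values: "finite ((\<lambda>G. card (edge_set G)) ` rex_candidates n F)"
proof (rule finite_subset)
  show "(\<lambda>G. card (edge_set G)) ` rex_candidates n F \<subseteq> {.. 2 ^ n}"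
  proof clarsimp
    fix G assume "G \<in> rex_candidates n F"
    then have G: "pair_graph G" and n: "card (pverts G) = n"
      by (auto simp: rex_candidates_def)
    interpret pair_graph G by fact
    have "edge_set G \<subseteq> Pow (pverts G)"
      by (auto simp: edge_set_def dest: in_arcsD1 in_arcsD2)
    then have "card (edge_set G) \<le> card (Pow (pverts G))"
      by (intro card_mono) (use pair_finite_verts in auto)
    then show "card (edge_set G) \<le> 2 ^ n"
      using n pair_finite_verts by (simp add: card_Pow)
  qed
qed simp

lemma rex_candidates_nonempty:
  assumes "parcs F \<noteq> {}"
  shows "rex_candidates n F \<noteq> {}"
proof -
  define G :: "nat pair_pre_digraph" where "G = \<lparr> pverts = {..<n}, parcs = {} \<rparr>"
  have "pair_graph G"
    by unfold_locales (auto simp: G_def symmetric_def sym_def)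
  moreover have "regular_graph G"
    by (auto simp: regular_graph_def out_degree_def out_arcs_def G_def)
  moreover have "\<not> contains_copy G F"
    using assms by (auto simp: contains_copy_def subgraph_def digraph_iso_def G_def
        dest: arg_cong[where f = arcs])
  ultimately have "G \<in> rex_candidates n F"
    by (simp add: rex_candidates_def G_def)
  then show ?thesis by blast
qed

end

theory Submission
  imports Defs "HOL-Algebra.Algebraic_Closure_Type" "HOL-Library.Function_Algebras"
begin

text \<open>
  The bound comes from the projective norm graph of Alon, Ronyai and Szabo: with \<open>d = s - 1\<close>, the
  pairs \<open>(A, a)\<close> in \<open>GF(q^d) \<times> GF(q)*\<close> are related if \<open>N(A + B) = a b\<close>. Its bipartite version is the
  sum graph of an abelian group of order \<open>q^d (q - 1)\<close>, so any \<open>k\<close> of its labels \<open>(u, N u)\<close> span a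
  \<open>k\<close>-regular subgraph.

  That \<open>s\<close> vertices have at most \<open>d!\<close> common neighbours reduces to a theorem of Kollar, Ronyai and
  Szabo: a system \<open>\<Prod>\<^sub>k (x\<^sub>k - a\<^sub>i\<^sub>k) = b\<^sub>i\<close> of \<open>d\<close> equations in \<open>d\<close> unknowns whose coefficients are
  distinct in each column has at most \<open>d!\<close> solutions. Modulo the \<open>L\<close>-th power of the ideal of the system,
  every polynomial has degree at most \<open>L + d\<close> in each variable, which leaves a space of dimension at most
  \<open>(L + d + 1)^d\<close>; the jets of order \<open>< L\<close> at \<open>m\<close> solutions need dimension about \<open>m L^d / d!\<close>. Now let
  \<open>L\<close> tend to infinity.

  To reach every order \<open>n\<close>, vertices are added without creating a \<open>K\<^sub>s\<^sub>,\<^sub>t\<close>. A left vertex \<open>z\<close> and the right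
  vertex \<open>g - z\<close> are cloned along labels \<open>c\<close> and \<open>b\<close> not used by the graph itself, so that a clone shares no
  neighbour with its original. If \<open>a = b + c - g\<close> is a used label, then deleting the edge with label \<open>a\<close> that
  joins the new neighbours \<open>b - (g - z)\<close> and \<open>c - z\<close> restores regularity. For a fixed \<open>g\<close> the label determines the
  deleted edge from \<open>z\<close>, so all these operations are independent. In the norm graph, \<open>g = (0, 1)\<close> and
  \<open>b = w + 1\<close>, \<open>c = 1 + 1/w\<close> work because then \<open>b + c = b c\<close>. For odd \<open>n\<close> one pair of clones is merged into
  a single vertex, each keeping half of its edges.
\<close>

subsection \<open>Systems of products of linear forms\<close>

interpretation fn: vector_space "(\<lambda>c f x. c * f x) :: 'a::field \<Rightarrow> ('b \<Rightarrow> 'a) \<Rightarrow> 'b \<Rightarrow> 'a"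
  by unfold_locales (auto simp: fun_eq_iff algebra_simps)

lemma sum_fun_apply: "(\<Sum>i\<in>A. f i) x = (\<Sum>i\<in>A. f i x)"
  by (induction A rule: infinite_finite_induct) auto

text \<open>Polynomials are represented by the functions they induce, which form a vector space at
  once; over an infinite field no information is lost. Coordinates outside \<open>K\<close> are
  ignored.\<close>

definition monomial_fun :: "'i set \<Rightarrow> ('i \<Rightarrow> nat) \<Rightarrow> ('i \<Rightarrow> 'a::field) \<Rightarrow> 'a" where
  "monomial_fun K \<alpha> x = (\<Prod>k\<in>K. x k ^ \<alpha> k)"

definition polybox :: "'i set \<Rightarrow> ('i \<Rightarrow> nat) \<Rightarrow> (('i \<Rightarrow> 'a::field) \<Rightarrow> 'a) set" where
  "polybox K N = fn.span {monomial_fun K \<alpha> |\<alpha>. \<forall>k\<in>K. \<alpha> k \<le> N k}"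

lemma subspace_polybox [simp]: "fn.subspace (polybox K N)"
  by (simp add: polybox_def)

lemma polybox_scale: "f \<in> polybox K N \<Longrightarrow> (\<lambda>x. c * f x) \<in> polybox K N"
  using fn.subspace_scale[OF subspace_polybox, of f K N c] by simp

lemma polybox_mono: "(\<And>k. k \<in> K \<Longrightarrow> N k \<le> N' k) \<Longrightarrow> polybox K N \<subseteq> polybox K N'"
  unfolding polybox_def by (intro fn.span_mono) (auto intro: order.trans)

lemma monomial_fun_in_polybox: "(\<And>k. k \<in> K \<Longrightarrow> \<alpha> k \<le> N k) \<Longrightarrow> monomial_fun K \<alpha> \<in> polybox K N"
  unfolding polybox_def by (intro fn.span_base) auto

lemma polybox_cong: "(\<And>k. k \<in> K \<Longrightarrow> N k = N' k) \<Longrightarrow> polybox K N = polybox K N'"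
  by (intro antisym polybox_mono) auto

lemma degree_prod_linear_le:
  fixes a :: "'j \<Rightarrow> 'a::field"
  assumes "finite J"
  shows "Polynomial.degree (\<Prod>l\<in>J. [:- a l, 1:]) \<le> card J"
  using degree_prod_sum_le[OF assms, of "\<lambda>l. [:- a l, 1:]"] by (simp add: o_def)

lemma subspace_mult_preimage:
  fixes W :: "('b \<Rightarrow> 'a::field) set"
  assumes "fn.subspace W"
  shows "fn.subspace {f. (\<lambda>x. c x * f x) \<in> W}"
proof (rule fn.subspaceI)
  show "0 \<in> {f. (\<lambda>x. c x * f x) \<in> W}"
    using fn.subspace_0[OF assms] by (simp add: zero_fun_def)
next
  fix f g assume "f \<in> {f. (\<lambda>x. c x * f x) \<in> W}" "g \<in> {f. (\<lambda>x. c x * f x) \<in> W}"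
  then show "f + g \<in> {f. (\<lambda>x. c x * f x) \<in> W}"
    using fn.subspace_add[OF assms, of "\<lambda>x. c x * f x" "\<lambda>x. c x * g x"]
    by (simp add: plus_fun_def algebra_simps)
next
  fix a f assume "f \<in> {f. (\<lambda>x. c x * f x) \<in> W}"
  then show "(\<lambda>x. a * f x) \<in> {f. (\<lambda>x. c x * f x) \<in> W}"
    using fn.subspace_scale[OF assms, of "\<lambda>x. c x * f x" a]
    by (simp add: algebra_simps)
qed

text \<open>Multiplication by \<open>c\<close> is linear, so the functions it sends into
  \<open>W\<close> form a subspace and generators suffice. Products of box elements are thereby
  checked on monomials only.\<close>

lemma span_mult_closed:
  fixes W :: "('b \<Rightarrow> 'a::field) set"
  assumes "fn.subspace W" "f \<in> fn.span S" "\<And>g. g \<in> S \<Longrightarrow> (\<lambda>x. c x * g x) \<in> W"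
  shows "(\<lambda>x. c x * f x) \<in> W"
  using fn.span_minimal[OF _ subspace_mult_preimage[OF assms(1)], of S c] assms(2,3) by blast

lemma poly_mult_closed:
  fixes W :: "('b \<Rightarrow> 'a::field) set"
  assumes W: "fn.subspace W" and "\<And>e. e \<le> Polynomial.degree p \<Longrightarrow> (\<lambda>x. y x ^ e * f x) \<in> W"
  shows "(\<lambda>x. poly p (y x) * f x) \<in> W"
proof -
  have "(\<Sum>e\<le>Polynomial.degree p. (\<lambda>x. Polynomial.coeff p e * (y x ^ e * f x))) \<in> W"
    by (intro fn.subspace_sum[OF W] fn.subspace_scale[OF W] assms(2)) auto
  also have "(\<Sum>e\<le>Polynomial.degree p. (\<lambda>x. Polynomial.coeff p e * (y x ^ e * f x)))
           = (\<lambda>x. poly p (y x) * f x)"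
    by (auto simp: fun_eq_iff poly_altdef sum_distrib_right sum_fun_apply mult.assoc)
  finally show ?thesis .
qed

text \<open>Each monomial over \<open>insert k K\<close> splits into a power of \<open>x k\<close>
  and a monomial over \<open>K\<close>, which allows inductions that treat one variable at a
  time.\<close>

lemma polybox_insert_subset:
  fixes W :: "(('i \<Rightarrow> 'a::field) \<Rightarrow> 'a) set"
  assumes "finite K" "k \<notin> K" "fn.subspace W"
    and "\<And>e f. e \<le> N k \<Longrightarrow> f \<in> polybox K N \<Longrightarrow> (\<lambda>x. x k ^ e * f x) \<in> W"
  shows "polybox (insert k K) N \<subseteq> W"
  unfolding polybox_def
proof (rule fn.span_minimal[OF _ assms(3)], clarify)
  fix \<alpha> :: "'i \<Rightarrow> nat" assume "\<forall>k\<in>insert k K. \<alpha> k \<le> N k"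
  moreover have "monomial_fun (insert k K) \<alpha> = (\<lambda>x :: 'i \<Rightarrow> 'a. x k ^ \<alpha> k * monomial_fun K \<alpha> x)"
    using assms(1,2) by (simp add: monomial_fun_def fun_eq_iff)
  ultimately show "monomial_fun (insert k K) \<alpha> \<in> W"
    using assms(4)[OF _ monomial_fun_in_polybox, of "\<alpha> k" \<alpha>] by auto
qed

lemma polybox_mult_power:
  assumes "finite K" "k \<notin> K" "e \<le> N k" "f \<in> polybox K N"
  shows "(\<lambda>x. x k ^ e * f x) \<in> polybox (insert k K) N"
proof (rule span_mult_closed[OF subspace_polybox assms(4)[unfolded polybox_def]])
  fix g :: "('a \<Rightarrow> 'b) \<Rightarrow> 'b" assume "g \<in> {monomial_fun K \<alpha> |\<alpha>. \<forall>k\<in>K. \<alpha> k \<le> N k}"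
  then obtain \<alpha> where \<alpha>: "g = monomial_fun K \<alpha>" "\<forall>k\<in>K. \<alpha> k \<le> N k" by auto
  have "(\<lambda>x::'a \<Rightarrow> 'b. x k ^ e * g x) = monomial_fun (insert k K) (\<alpha>(k := e))"
  proof
    fix x :: "'a \<Rightarrow> 'b"
    have "(\<Prod>j\<in>K. x j ^ (\<alpha>(k := e)) j) = (\<Prod>j\<in>K. x j ^ \<alpha> j)"
      using assms(2) by (intro prod.cong) auto
    then show "x k ^ e * g x = monomial_fun (insert k K) (\<alpha>(k := e)) x"
      using assms(1,2) by (simp add: \<alpha>(1) monomial_fun_def)
  qed
  also have "\<dots> \<in> polybox (insert k K) N"
    using \<alpha>(2) assms(3) by (intro monomial_fun_in_polybox) auto
  finally show "(\<lambda>x. x k ^ e * g x) \<in> polybox (insert k K) N" .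
qed

lemma polybox_mult_poly:
  assumes "finite K" "k \<notin> K" "Polynomial.degree p \<le> N k" "f \<in> polybox K N"
  shows "(\<lambda>x. poly p (x k) * f x) \<in> polybox (insert k K) N"
  by (intro poly_mult_closed subspace_polybox polybox_mult_power) (use assms in auto)

lemma prod_poly_in_polybox:
  assumes "finite K" "\<And>k. k \<in> K \<Longrightarrow> Polynomial.degree (p k) \<le> N k"
  shows "(\<lambda>x. \<Prod>k\<in>K. poly (p k) (x k)) \<in> polybox K N"
  using assms
proof (induction K rule: finite_induct)
  case empty
  then show ?case
    using monomial_fun_in_polybox[of "{}" "\<lambda>_. 0" N] by (simp add: monomial_fun_def[abs_def])
next
  case (insert k K)
  then show ?case
    using polybox_mult_poly[of K k "p k" N "\<lambda>x. \<Prod>k\<in>K. poly (p k) (x k)"] by simp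
qed

section \<open>Products of linear factors and the ideal they span\<close>

lemma polybox_mult_linear_factors:
  assumes "finite K" "f \<in> polybox K N" "\<And>k. k \<in> K \<Longrightarrow> Suc (N k) \<le> N' k"
  shows "(\<lambda>x. (\<Prod>k\<in>K. x k - a k) * f x) \<in> polybox K N'"
proof (rule span_mult_closed[OF subspace_polybox assms(2)[unfolded polybox_def]])
  fix g :: "('a \<Rightarrow> 'b) \<Rightarrow> 'b" assume "g \<in> {monomial_fun K \<alpha> |\<alpha>. \<forall>k\<in>K. \<alpha> k \<le> N k}"
  then obtain \<alpha> where \<alpha>: "g = monomial_fun K \<alpha>" "\<forall>k\<in>K. \<alpha> k \<le> N k" by auto
  have "Polynomial.degree ([:- a k, 1:] * Polynomial.monom 1 (\<alpha> k)) \<le> N' k" if "k \<in> K" for k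
    using degree_mult_le[of "[:- a k, 1:]" "Polynomial.monom 1 (\<alpha> k)"] assms(3)[OF that] \<alpha>(2) that
    by (fastforce simp: degree_monom_eq)
  then have "(\<lambda>x. \<Prod>k\<in>K. poly ([:- a k, 1:] * Polynomial.monom 1 (\<alpha> k)) (x k)) \<in> polybox K N'"
    using assms(1) by (intro prod_poly_in_polybox) auto
  then show "(\<lambda>x. (\<Prod>k\<in>K. x k - a k) * g x) \<in> polybox K N'"
    by (simp only: \<alpha>(1) monomial_fun_def prod.distrib poly_monom poly_mult) simp
qed

text \<open>The \<open>i\<close>-th product is the left-hand side of the \<open>i\<close>-th
  equation; the constant \<open>b i\<close> has lower degree and is dealt with later. Cofactors have
  degree at most \<open>N k - 1\<close> in \<open>x k\<close>, so for positive \<open>N\<close> the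
  products stay in the box \<open>N\<close>.\<close>

definition polybox_ideal ::
  "'i set \<Rightarrow> 'j set \<Rightarrow> ('j \<Rightarrow> 'i \<Rightarrow> 'a::field) \<Rightarrow> ('i \<Rightarrow> nat) \<Rightarrow> (('i \<Rightarrow> 'a) \<Rightarrow> 'a) set" where
  "polybox_ideal K I a N =
     fn.span {\<lambda>x. (\<Prod>k\<in>K. x k - a i k) * g x |i g. i \<in> I \<and> g \<in> polybox K (\<lambda>k. N k - 1)}"

lemma subspace_polybox_ideal [simp]: "fn.subspace (polybox_ideal K I a N)"
  by (simp add: polybox_ideal_def)

lemma polybox_ideal_base:
  "i \<in> I \<Longrightarrow> g \<in> polybox K (\<lambda>k. N k - 1) \<Longrightarrow> (\<lambda>x. (\<Prod>k\<in>K. x k - a i k) * g x) \<in> polybox_ideal K I a N"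
  unfolding polybox_ideal_def by (intro fn.span_base) blast

text \<open>Expand \<open>f\<close> in generators over \<open>K\<close>. In the term of equation
  \<open>i \<in> J\<close>, the factor \<open>x k - a i k\<close> of the product over
  \<open>J\<close> completes the generator over \<open>insert k K\<close>; the other
  \<open>card J - 1\<close> factors and \<open>x k ^ e\<close> go into the cofactor.\<close>

lemma polybox_ideal_insert:
  assumes fin: "finite K" "k \<notin> K" "finite J" and "J \<subseteq> I"
    and sub: "polybox K N \<subseteq> polybox_ideal K J a N" and e: "e + card J \<le> N k" and f: "f \<in> polybox K N"
  shows "(\<lambda>x. (x k ^ e * (\<Prod>i\<in>J. x k - a i k)) * f x) \<in> polybox_ideal (insert k K) I a N"
proof -
  have "f \<in> polybox_ideal K J a N" using sub f by blast
  then show ?thesis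
    unfolding polybox_ideal_def[of K]
  proof (rule span_mult_closed[OF subspace_polybox_ideal])
    fix h assume "h \<in> {\<lambda>x. (\<Prod>k\<in>K. x k - a i k) * g x |i g. i \<in> J \<and> g \<in> polybox K (\<lambda>k. N k - 1)}"
    then obtain i g where i: "i \<in> J" and g: "g \<in> polybox K (\<lambda>k. N k - 1)"
      and h: "h = (\<lambda>x. (\<Prod>k\<in>K. x k - a i k) * g x)" by blast
    define p where "p = Polynomial.monom 1 e * (\<Prod>l\<in>J - {i}. [:- a l k, 1:])"
    have "Polynomial.degree p \<le> e + card (J - {i})"
      unfolding p_def
      by (intro order.trans[OF degree_mult_le] add_mono degree_monom_le degree_prod_linear_le)
         (use fin in auto)
    also have "\<dots> \<le> N k - 1"
      using e i fin card_gt_0_iff[of J] by (cases "card J") auto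
    finally have "(\<lambda>x. poly p (x k) * g x) \<in> polybox (insert k K) (\<lambda>k. N k - 1)"
      by (intro polybox_mult_poly fin g)
    then have "(\<lambda>x. (\<Prod>k\<in>insert k K. x k - a i k) * (poly p (x k) * g x)) \<in> polybox_ideal (insert k K) I a N"
      using i \<open>J \<subseteq> I\<close> by (intro polybox_ideal_base) auto
    also have "(\<lambda>x. (\<Prod>k\<in>insert k K. x k - a i k) * (poly p (x k) * g x))
        = (\<lambda>x. (x k ^ e * (\<Prod>i\<in>J. x k - a i k)) * h x)"
      using fin i by (simp add: fun_eq_iff h p_def poly_monom poly_prod prod.remove[of J i])
    finally show "(\<lambda>x. (x k ^ e * (\<Prod>i\<in>J. x k - a i k)) * h x) \<in> polybox_ideal (insert k K) I a N" .
  qed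
qed

text \<open>Lagrange interpolation at the nodes \<open>a i\<close>, with the normalising
  denominators absorbed into the coefficients.\<close>

lemma Lagrange_basis:
  fixes p :: "'a::field poly"
  assumes "finite I" "inj_on a I" "Polynomial.degree p < card I"
  obtains c where "\<And>x. poly p x = (\<Sum>i\<in>I. c i * (\<Prod>l\<in>I - {i}. x - a l))"
proof -
  define c where "c i = poly p (a i) / (\<Prod>l\<in>I - {i}. a i - a l)" for i
  define r where "r = (\<Sum>i\<in>I. Polynomial.smult (c i) (\<Prod>l\<in>I - {i}. [:- a l, 1:]))"
  have r: "poly r x = (\<Sum>i\<in>I. c i * (\<Prod>l\<in>I - {i}. x - a l))" for x
    by (simp add: r_def poly_sum poly_prod)
  have "Polynomial.degree (Polynomial.smult (c i) (\<Prod>l\<in>I - {i}. [:- a l, 1:])) \<le> card I - 1" if "i \<in> I" for i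
    using degree_prod_linear_le[of "I - {i}" a] assms(1) that
    by (auto intro: order.trans[OF degree_smult_le])
  then have "Polynomial.degree r \<le> card I - 1"
    unfolding r_def using assms(1) by (intro degree_sum_le) auto
  then have "Polynomial.degree r < card (a ` I)"
    using assms by (simp add: card_image)
  moreover have "poly p x = poly r x" if "x \<in> a ` I" for x
  proof -
    from that obtain i where i: "i \<in> I" "x = a i" by blast
    have "(\<Prod>l\<in>I - {j}. a i - a l) = 0" if "j \<in> I - {i}" for j
      using that i assms(1) by (intro prod_zero) auto
    then have "(\<Sum>j\<in>I - {i}. c j * (\<Prod>l\<in>I - {j}. a i - a l)) = 0"
      by (intro sum.neutral ballI) simp
    then have "poly r x = c i * (\<Prod>l\<in>I - {i}. a i - a l)"
      unfolding r using i assms(1) by (simp add: sum.remove[of I i])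
    moreover have "(\<Prod>l\<in>I - {i}. a i - a l) \<noteq> 0"
      using assms(1,2) i by (auto simp: prod_zero_iff dest: inj_onD)
    ultimately show ?thesis by (simp add: c_def i)
  qed
  ultimately have "p = r"
    using assms by (intro poly_eqI_degree[of "a ` I"]) (auto simp: card_image)
  then show thesis using that[of c] r by simp
qed

text \<open>
  Leaving out one of the \<open>card K + 1\<close> equations gives the claim for one variable fewer, multiplied by the
  product of the remaining linear factors in the new variable. These products form a Lagrange basis.
\<close>

lemma polybox_subset_polybox_ideal:
  fixes a :: "'j \<Rightarrow> 'i \<Rightarrow> 'a::field"
  assumes "finite K" "finite I" "card I = Suc (card K)"
    and "\<And>k. k \<in> K \<Longrightarrow> inj_on (\<lambda>i. a i k) I" "\<And>k. k \<in> K \<Longrightarrow> card K \<le> N k"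
  shows "polybox K N \<subseteq> polybox_ideal K I a N"
  using assms
proof (induction K arbitrary: I rule: finite_induct)
  case empty
  then obtain i where "I = {i}" by (auto simp: card_1_singleton_iff)
  moreover have "polybox {} N = polybox {} (\<lambda>k. N k - 1)" by (rule polybox_cong) auto
  ultimately show ?case using polybox_ideal_base[of i I _ "{}" N a] by auto
next
  case (insert k K)
  define m where "m = card (insert k K)"
  have m: "m = Suc (card K)" "card I = Suc m" "m \<le> N k"
    using insert by (auto simp: m_def)
  show ?case
  proof (rule polybox_insert_subset[OF insert.hyps(1,2) subspace_polybox_ideal])
    fix e and f :: "('i \<Rightarrow> 'a) \<Rightarrow> 'a" assume e: "e \<le> N k" and f: "f \<in> polybox K N"
    \<comment> \<open>\<open>m = card I - 1\<close> is the largest degree that the Lagrange basis on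
      \<open>I\<close> reaches, so only \<open>x k ^ min e m\<close> is expanded and
      \<open>x k ^ (e - m)\<close> stays as a factor.\<close>
    obtain c where c: "\<And>x. poly (Polynomial.monom 1 (min e m)) x = (\<Sum>i\<in>I. c i * (\<Prod>l\<in>I - {i}. x - a l k))"
      by (rule Lagrange_basis[of I "\<lambda>i. a i k" "Polynomial.monom 1 (min e m)"])
         (use insert.prems m in \<open>auto simp: degree_monom_eq\<close>)
    have "(\<lambda>x. (x k ^ (e - m) * (\<Prod>l\<in>I - {i}. x k - a l k)) * f x) \<in> polybox_ideal (insert k K) I a N"
      if "i \<in> I" for i
    proof (rule polybox_ideal_insert)
      show "polybox K N \<subseteq> polybox_ideal K (I - {i}) a N"
        using insert.prems that m by (intro insert.IH) (auto intro: inj_on_subset Suc_leD)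
      show "e - m + card (I - {i}) \<le> N k"
        using insert.prems(1) that m e by simp
    qed (use insert that f in auto)
    then have "(\<Sum>i\<in>I. (\<lambda>x. c i * ((x k ^ (e - m) * (\<Prod>l\<in>I - {i}. x k - a l k)) * f x)))
        \<in> polybox_ideal (insert k K) I a N"
      by (intro fn.subspace_sum fn.subspace_scale subspace_polybox_ideal)
    also have "(\<Sum>i\<in>I. (\<lambda>x. c i * ((x k ^ (e - m) * (\<Prod>l\<in>I - {i}. x k - a l k)) * f x)))
        = (\<lambda>x. x k ^ (e - m) * poly (Polynomial.monom 1 (min e m)) (x k) * f x)"
      unfolding c by (simp add: fun_eq_iff sum_fun_apply sum_distrib_left sum_distrib_right mult_ac)
    also have "\<dots> = (\<lambda>x. x k ^ e * f x)"
    proof -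
      have "e - m + min e m = e" by simp
      then show ?thesis by (simp add: poly_monom flip: power_add)
    qed
    finally show "(\<lambda>x. x k ^ e * f x) \<in> polybox_ideal (insert k K) I a N" .
  qed
qed


text \<open>The \<open>card D\<close> equations are one too few for \<open>D\<close>, but
  \<open>polybox_subset_polybox_ideal\<close> still applies to the variables other than
  \<open>k\<close>. So modulo the ideal \<open>x k ^ N k\<close> can be traded for smaller powers of
  \<open>x k\<close>, by subtracting a multiple of the product of all
  \<open>x k - a i k\<close>.\<close>

lemma polybox_lower_one_variable:
  fixes a :: "'j \<Rightarrow> 'i \<Rightarrow> 'a::field"
  assumes "finite D" "finite I" "card I = card D" "k \<in> D"
    and inj: "\<And>k. k \<in> D \<Longrightarrow> inj_on (\<lambda>i. a i k) I" and N: "\<And>k. k \<in> D \<Longrightarrow> card D \<le> N k"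
    and W: "fn.subspace W" "polybox_ideal D I a N \<subseteq> W" "polybox D (N(k := N k - 1)) \<subseteq> W"
  shows "polybox D N \<subseteq> W"
proof -
  define K where "K = D - {k}"
  have K: "finite K" "k \<notin> K" "D = insert k K" "card I = Suc (card K)" "card I \<le> N k" "0 < N k"
  proof -
    have "0 < card D" using assms(1,4) card_gt_0_iff by blast
    then show "card I = Suc (card K)" "card I \<le> N k" "0 < N k"
      using assms(1,3,4) N[of k] by (simp_all add: K_def)
  qed (use assms(1,4) in \<open>auto simp: K_def\<close>)
  have "polybox (insert k K) N \<subseteq> W"
  proof (rule polybox_insert_subset[OF K(1,2) W(1)])
    fix e and f :: "('i \<Rightarrow> 'a) \<Rightarrow> 'a" assume e: "e \<le> N k" and f: "f \<in> polybox K N"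
    have f': "f \<in> polybox K (N(k := N k - 1))"
      using f K(2) by (subst polybox_cong[of K _ N]) auto
    show "(\<lambda>x. x k ^ e * f x) \<in> W"
    proof (cases "e < N k")
      case True
      then show ?thesis
        using polybox_mult_power[OF K(1,2) _ f', of e] W(3) K(3) by auto
    next
      case False
      \<comment> \<open>Here \<open>e = N k\<close>. As \<open>q\<close> is monic of degree
        \<open>e\<close>, the difference \<open>p\<close> has degree at most \<open>N k - 1\<close>,
        while \<open>q\<close> itself is handled by the ideal.\<close>
      define q where "q = Polynomial.monom 1 (e - card I) * (\<Prod>i\<in>I. [:- a i k, 1:])"
      define p where "p = Polynomial.monom 1 e - q"
      have I: "Polynomial.degree (\<Prod>i\<in>I. [:- a i k, 1:]) = card I" "Polynomial.lead_coeff (\<Prod>i\<in>I. [:- a i k, 1:]) = 1"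
      proof -
        show "Polynomial.degree (\<Prod>i\<in>I. [:- a i k, 1:]) = card I"
          by (simp add: degree_prod_eq_sum_degree)
        show "Polynomial.lead_coeff (\<Prod>i\<in>I. [:- a i k, 1:]) = 1"
          unfolding lead_coeff_prod by simp
      qed
      then have q: "Polynomial.degree q = e" "Polynomial.coeff q e = 1"
      proof -
        have "(\<Prod>i\<in>I. [:- a i k, 1:]) \<noteq> 0" using I(2) by auto
        then show "Polynomial.degree q = e"
          using False e K(5) I(1) by (simp add: q_def degree_mult_eq degree_monom_eq monom_eq_0_iff)
        then show "Polynomial.coeff q e = 1"
          using I(2) lead_coeff_mult[of "Polynomial.monom 1 (e - card I)" "\<Prod>i\<in>I. [:- a i k, 1:]"]
          by (simp add: q_def degree_monom_eq)
      qed
      have "Polynomial.degree p \<le> N k - 1"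
      proof (rule degree_le, safe)
        fix j assume "N k - 1 < j"
        then show "Polynomial.coeff p j = 0"
          using q e False by (cases "j = e") (auto simp: p_def coeff_eq_0)
      qed
      then have "(\<lambda>x. poly p (x k) * f x) \<in> W"
        using polybox_mult_poly[OF K(1,2) _ f', of p] W(3) K(3) by auto
      moreover have "(\<lambda>x. (x k ^ (e - card I) * (\<Prod>i\<in>I. x k - a i k)) * f x) \<in> W"
      proof -
        have "polybox K N \<subseteq> polybox_ideal K I a N"
          using assms K by (intro polybox_subset_polybox_ideal) (auto intro: Suc_leD)
        then have "(\<lambda>x. (x k ^ (e - card I) * (\<Prod>i\<in>I. x k - a i k)) * f x) \<in> polybox_ideal (insert k K) I a N"
          using False e K f assms(2) by (intro polybox_ideal_insert[where J = I]) auto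
        then show ?thesis using W(2) K(3) by auto
      qed
      ultimately have "(\<lambda>x. poly p (x k) * f x)
          + (\<lambda>x. (x k ^ (e - card I) * (\<Prod>i\<in>I. x k - a i k)) * f x) \<in> W"
        by (rule fn.subspace_add[OF W(1)])
      also have "(\<lambda>x. poly p (x k) * f x) + (\<lambda>x. (x k ^ (e - card I) * (\<Prod>i\<in>I. x k - a i k)) * f x)
          = (\<lambda>x. x k ^ e * f x)"
        by (simp add: fun_eq_iff p_def q_def poly_monom poly_prod algebra_simps)
      finally show ?thesis .
    qed
  qed
  then show ?thesis using K(3) by simp
qed

text \<open>Induction on the set \<open>T\<close> of variables with bound \<open>N\<close>, the
  others having bound \<open>N - 1\<close>; for \<open>T = {}\<close> the claim is a
  hypothesis.\<close>

lemma polybox_lower: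
  fixes a :: "'j \<Rightarrow> 'i \<Rightarrow> 'a::field"
  assumes D: "finite D" "finite I" "card I = card D"
    and inj: "\<And>k. k \<in> D \<Longrightarrow> inj_on (\<lambda>i. a i k) I" and N: "card D < N"
    and W: "fn.subspace W" "polybox_ideal D I a (\<lambda>_. N) \<subseteq> W" "polybox D (\<lambda>_. N - 1) \<subseteq> W"
  shows "polybox D (\<lambda>_. N) \<subseteq> W"
proof -
  have "polybox D (\<lambda>k. if k \<in> T then N else N - 1) \<subseteq> W" if "finite T" "T \<subseteq> D" for T
    using that
  proof (induction T rule: finite_induct)
    case empty
    then show ?case using W(3) by simp
  next
    case (insert k T)
    let ?N = "\<lambda>j. if j \<in> insert k T then N else N - 1"
    show ?case
    proof (rule polybox_lower_one_variable[OF D, of k a])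
      show "polybox_ideal D I a ?N \<subseteq> W"
      proof -
        have "polybox D (\<lambda>k. ?N k - 1) \<subseteq> polybox D (\<lambda>_. N - 1)"
          by (intro polybox_mono) auto
        then have "polybox_ideal D I a ?N \<subseteq> polybox_ideal D I a (\<lambda>_. N)"
          unfolding polybox_ideal_def by (intro fn.span_mono) blast
        then show ?thesis using W(2) by blast
      qed
      have "?N(k := ?N k - 1) = (\<lambda>j. if j \<in> T then N else N - 1)"
        using insert.hyps by (auto simp: fun_eq_iff)
      then show "polybox D (?N(k := ?N k - 1)) \<subseteq> W"
        using insert by simp
    qed (use insert.prems inj N W(1) in auto)
  qed
  moreover have "polybox D (\<lambda>_. N) = (polybox D (\<lambda>k. if k \<in> D then N else N - 1) :: (('i \<Rightarrow> 'a) \<Rightarrow> 'a) set)"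
    by (rule polybox_cong) simp
  ultimately show ?thesis using D(1) by simp
qed

section \<open>Order of vanishing along lines\<close>

text \<open>Restricting to lines avoids derivatives, which do not detect the order in characteristic \<open>p\<close>.\<close>

definition vanishes_to_order :: "('i \<Rightarrow> 'a::field) set \<Rightarrow> nat \<Rightarrow> (('i \<Rightarrow> 'a) \<Rightarrow> 'a) \<Rightarrow> bool" where
  "vanishes_to_order V L f \<longleftrightarrow>
     (\<forall>v\<in>V. \<forall>u. \<exists>r. \<forall>\<tau>. f (\<lambda>k. v k + \<tau> * u k) = \<tau> ^ L * poly r \<tau>)"

lemma subspace_vanishes_to_order: "fn.subspace {f. vanishes_to_order V L f}"
proof (rule fn.subspaceI)
  show "0 \<in> {f. vanishes_to_order V L f}"
    by (auto simp: vanishes_to_order_def intro!: exI[of _ 0])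
next
  fix f g assume "f \<in> {f. vanishes_to_order V L f}" "g \<in> {f. vanishes_to_order V L f}"
  then have fg: "vanishes_to_order V L f" "vanishes_to_order V L g" by auto
  have "vanishes_to_order V L (f + g)"
    unfolding vanishes_to_order_def
  proof (intro ballI allI)
    fix v u assume "v \<in> V"
    with fg obtain r r' where "\<forall>\<tau>. f (\<lambda>k. v k + \<tau> * u k) = \<tau> ^ L * poly r \<tau>"
      "\<forall>\<tau>. g (\<lambda>k. v k + \<tau> * u k) = \<tau> ^ L * poly r' \<tau>"
      unfolding vanishes_to_order_def by meson
    then show "\<exists>r. \<forall>\<tau>. (f + g) (\<lambda>k. v k + \<tau> * u k) = \<tau> ^ L * poly r \<tau>"
      by (intro exI[of _ "r + r'"]) (simp add: algebra_simps)
  qed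
  then show "f + g \<in> {f. vanishes_to_order V L f}" by simp
next
  fix c f assume "f \<in> {f. vanishes_to_order V L f}"
  then have f: "vanishes_to_order V L f" by auto
  have "vanishes_to_order V L (\<lambda>x. c * f x)"
    unfolding vanishes_to_order_def
  proof (intro ballI allI)
    fix v u assume "v \<in> V"
    with f obtain r where "\<forall>\<tau>. f (\<lambda>k. v k + \<tau> * u k) = \<tau> ^ L * poly r \<tau>"
      unfolding vanishes_to_order_def by meson
    then show "\<exists>r. \<forall>\<tau>. c * f (\<lambda>k. v k + \<tau> * u k) = \<tau> ^ L * poly r \<tau>"
      by (intro exI[of _ "Polynomial.smult c r"]) (simp add: algebra_simps)
  qed
  then show "(\<lambda>x. c * f x) \<in> {f. vanishes_to_order V L f}" by simp
qed

lemma vanishes_to_order_mult: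
  assumes "vanishes_to_order V L f" "vanishes_to_order V M g"
  shows "vanishes_to_order V (L + M) (\<lambda>x. f x * g x)"
  unfolding vanishes_to_order_def
proof (intro ballI allI)
  fix v u assume "v \<in> V"
  with assms obtain r r' where "\<forall>\<tau>. f (\<lambda>k. v k + \<tau> * u k) = \<tau> ^ L * poly r \<tau>"
    "\<forall>\<tau>. g (\<lambda>k. v k + \<tau> * u k) = \<tau> ^ M * poly r' \<tau>"
    unfolding vanishes_to_order_def by meson
  then show "\<exists>r. \<forall>\<tau>. f (\<lambda>k. v k + \<tau> * u k) * g (\<lambda>k. v k + \<tau> * u k) = \<tau> ^ (L + M) * poly r \<tau>"
    by (intro exI[of _ "r * r'"]) (simp add: power_add algebra_simps)
qed

text \<open>For order 0 the definition only asks that the restriction to each line through a point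
  of \<open>V\<close> be a polynomial in the parameter.\<close>

lemma vanishes_to_order_polybox:
  assumes "f \<in> polybox K N"
  shows "vanishes_to_order V 0 f"
proof -
  have "polybox K N \<subseteq> {f. vanishes_to_order V 0 f}"
    unfolding polybox_def
  proof (rule fn.span_minimal[OF _ subspace_vanishes_to_order], clarify)
    fix \<alpha> :: "'a \<Rightarrow> nat"
    show "vanishes_to_order V 0 (monomial_fun K \<alpha>)"
      unfolding vanishes_to_order_def monomial_fun_def
    proof (intro ballI allI)
      fix v u :: "'a \<Rightarrow> 'b"
      show "\<exists>r. \<forall>\<tau>. (\<Prod>k\<in>K. (v k + \<tau> * u k) ^ \<alpha> k) = \<tau> ^ 0 * poly r \<tau>"
        by (rule exI[of _ "\<Prod>k\<in>K. [:v k, u k:] ^ \<alpha> k"]) (simp add: poly_prod)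
    qed
  qed
  then show ?thesis using assms by blast
qed

text \<open>Along a line through a solution the difference is a polynomial in \<open>\<tau>\<close>
  with root 0, hence divisible by \<open>\<tau>\<close>.\<close>

lemma vanishes_to_order_equation:
  fixes a :: "'i \<Rightarrow> 'a::field"
  assumes "\<And>v. v \<in> V \<Longrightarrow> (\<Prod>k\<in>D. v k - a k) = b"
  shows "vanishes_to_order V 1 (\<lambda>x. (\<Prod>k\<in>D. x k - a k) - b)"
  unfolding vanishes_to_order_def
proof (intro ballI allI)
  fix v u assume v: "v \<in> V"
  define p where "p = (\<Prod>k\<in>D. [:v k - a k, u k:]) - [:b:]"
  have "poly p 0 = 0"
    using assms[OF v] by (simp add: p_def poly_prod)
  then obtain r where "p = [:0, 1:] * r"
    by (metis dvdE poly_eq_0_iff_dvd neg_equal_0_iff_equal)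
  moreover have "(\<Prod>k\<in>D. v k + \<tau> * u k - a k) - b = poly p \<tau>" for \<tau>
    by (simp add: p_def poly_prod algebra_simps)
  ultimately show "\<exists>r. \<forall>\<tau>. (\<Prod>k\<in>D. v k + \<tau> * u k - a k) - b = \<tau> ^ 1 * poly r \<tau>"
    by (intro exI[of _ r]) simp
qed


text \<open>Induction on \<open>L\<close>, with \<open>polybox_lower\<close> applied to the sum of
  both spaces. A cofactor splits as \<open>g = z + h\<close> with \<open>z\<close> of order
  \<open>L\<close> and \<open>h\<close> in a smaller box. Subtracting \<open>b i\<close> from the
  product before multiplying by \<open>z\<close> gains one order, because the equation holds on
  \<open>V\<close>; everything else lies in the box \<open>N - 1\<close>.\<close>

lemma polybox_reduce_mod_order:
  fixes a :: "'j \<Rightarrow> 'i \<Rightarrow> 'a::field"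
  assumes D: "finite D" "D \<noteq> {}" "finite I" "card I = card D"
    and inj: "\<And>k. k \<in> D \<Longrightarrow> inj_on (\<lambda>i. a i k) I"
    and V: "\<And>v i. v \<in> V \<Longrightarrow> i \<in> I \<Longrightarrow> (\<Prod>k\<in>D. v k - a i k) = b i"
    and N: "L + card D \<le> N"
  shows "polybox D (\<lambda>_. N) \<subseteq> {f + g |f g. f \<in> {f. vanishes_to_order V L f} \<and> g \<in> polybox D (\<lambda>_. N - 1)}"
  using N
proof (induction L arbitrary: N)
  case 0
  show ?case
  proof
    fix f :: "('i \<Rightarrow> 'a) \<Rightarrow> 'a" assume "f \<in> polybox D (\<lambda>_. N)"
    then have "vanishes_to_order V 0 f" by (rule vanishes_to_order_polybox)
    moreover have "0 \<in> polybox D (\<lambda>_. N - 1)" by (rule fn.subspace_0) simp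
    moreover have "f = f + 0" by simp
    ultimately show "f \<in> {f + g |f g. f \<in> {f. vanishes_to_order V 0 f} \<and> g \<in> polybox D (\<lambda>_. N - 1)}"
      by blast
  qed
next
  case (Suc L)
  define W where "W = {f + g |f g. f \<in> {f. vanishes_to_order V (Suc L) f} \<and> g \<in> polybox D (\<lambda>_. N - 1)}"
  have W: "fn.subspace W"
    unfolding W_def by (intro fn.subspace_sums subspace_vanishes_to_order subspace_polybox)
  have W1: "f \<in> W" if "vanishes_to_order V (Suc L) f" for f
  proof -
    have "0 \<in> polybox D (\<lambda>_. N - 1)" by (rule fn.subspace_0) simp
    moreover have "f = f + 0" by simp
    ultimately show ?thesis using that unfolding W_def by blast
  qed
  have W2: "f \<in> W" if "f \<in> polybox D (\<lambda>_. N - 1)" for f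
  proof -
    have "0 \<in> {f. vanishes_to_order V (Suc L) f}"
      by (rule fn.subspace_0[OF subspace_vanishes_to_order])
    moreover have "f = 0 + f" by simp
    ultimately show ?thesis using that unfolding W_def by blast
  qed
  have card: "0 < card D" using D by (simp add: card_gt_0_iff)
  have "polybox D (\<lambda>_. N) \<subseteq> W"
  proof (rule polybox_lower[OF D(1,3,4) inj _ W])
    show "polybox D (\<lambda>_. N - 1) \<subseteq> W" using W2 by blast
    show "polybox_ideal D I a (\<lambda>_. N) \<subseteq> W"
      unfolding polybox_ideal_def
    proof (rule fn.span_minimal[OF _ W], clarify)
      fix i and g :: "('i \<Rightarrow> 'a) \<Rightarrow> 'a" assume i: "i \<in> I" and g: "g \<in> polybox D (\<lambda>_. N - 1)"
      have "L + card D \<le> N - 1" using Suc.prems by simp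
      from Suc.IH[OF this] g obtain z h where z: "vanishes_to_order V L z"
        and h: "h \<in> polybox D (\<lambda>_. N - 1 - 1)" and g_eq: "g = z + h" by blast
      let ?F = "\<lambda>x. (\<Prod>k\<in>D. x k - a i k) - b i"
      have "vanishes_to_order V (1 + L) (\<lambda>x. ?F x * z x)"
        by (intro vanishes_to_order_mult vanishes_to_order_equation z V i)
      then have "(\<lambda>x. ?F x * z x) \<in> W" by (intro W1) simp
      \<comment> \<open>\<open>h\<close> has bound \<open>N - 2\<close>, so one more linear factor
        in each variable gives bound \<open>N - 1\<close>.\<close>
      moreover have "(\<lambda>x. (\<Prod>k\<in>D. x k - a i k) * h x) \<in> W"
        by (intro W2 polybox_mult_linear_factors[OF D(1) h]) (use Suc.prems card in auto)
      moreover have "h \<in> polybox D (\<lambda>_. N - 1)"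
        using h by (rule subsetD[OF polybox_mono, rotated]) simp
      then have "(\<lambda>x. (- b i) * h x) \<in> W" by (intro W2 polybox_scale)
      moreover have "(\<lambda>x. b i * g x) \<in> W" by (intro W2 polybox_scale g)
      ultimately have "(\<lambda>x. ?F x * z x) + ((\<lambda>x. (\<Prod>k\<in>D. x k - a i k) * h x)
          + ((\<lambda>x. (- b i) * h x) + (\<lambda>x. b i * g x))) \<in> W"
        by (intro fn.subspace_add[OF W])
      also have "(\<lambda>x. ?F x * z x) + ((\<lambda>x. (\<Prod>k\<in>D. x k - a i k) * h x)
          + ((\<lambda>x. (- b i) * h x) + (\<lambda>x. b i * g x))) = (\<lambda>x. (\<Prod>k\<in>D. x k - a i k) * g x)"
        by (simp add: fun_eq_iff g_eq algebra_simps)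
      finally show "(\<lambda>x. (\<Prod>k\<in>D. x k - a i k) * g x) \<in> W" .
    qed
  qed (use Suc.prems card in simp_all)
  then show ?case unfolding W_def .
qed

text \<open>Iterating the reduction brings any degree down to \<open>L + card D\<close>, a bound
  independent of the size of \<open>V\<close>.\<close>

lemma polybox_reduce_to_fixed_degree:
  fixes a :: "'j \<Rightarrow> 'i \<Rightarrow> 'a::field"
  assumes D: "finite D" "D \<noteq> {}" "finite I" "card I = card D"
    and inj: "\<And>k. k \<in> D \<Longrightarrow> inj_on (\<lambda>i. a i k) I"
    and V: "\<And>v i. v \<in> V \<Longrightarrow> i \<in> I \<Longrightarrow> (\<Prod>k\<in>D. v k - a i k) = b i"
    and f: "f \<in> polybox D (\<lambda>_. N)"
  shows "\<exists>g\<in>polybox D (\<lambda>_. L + card D). vanishes_to_order V L (f - g)"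
  using f
proof (induction N arbitrary: f)
  case 0
  then have "f \<in> polybox D (\<lambda>_. L + card D)"
    using polybox_mono[of D "\<lambda>_. 0" "\<lambda>_. L + card D"] by auto
  moreover have "vanishes_to_order V L (f - f)"
    using fn.subspace_0[OF subspace_vanishes_to_order] by simp
  ultimately show ?case by blast
next
  case (Suc N)
  show ?case
  proof (cases "Suc N \<le> L + card D")
    case True
    then have "f \<in> polybox D (\<lambda>_. L + card D)"
      using polybox_mono[of D "\<lambda>_. Suc N" "\<lambda>_. L + card D"] Suc.prems by auto
    moreover have "vanishes_to_order V L (f - f)"
      using fn.subspace_0[OF subspace_vanishes_to_order] by simp
    ultimately show ?thesis by blast
  next
    case False
    then obtain z h where z: "vanishes_to_order V L z" and h: "h \<in> polybox D (\<lambda>_. N)" and f: "f = z + h"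
      using polybox_reduce_mod_order[where V = V and N = "Suc N" and L = L, OF D inj V] Suc.prems by auto
    obtain g where g: "g \<in> polybox D (\<lambda>_. L + card D)" "vanishes_to_order V L (h - g)"
      using Suc.IH[OF h] by blast
    have "z + (h - g) \<in> {f. vanishes_to_order V L f}"
      by (rule fn.subspace_add[OF subspace_vanishes_to_order]) (use z g in auto)
    moreover have "z + (h - g) = f - g" by (simp add: f)
    ultimately have "vanishes_to_order V L (f - g)" by (simp only: mem_Collect_eq)
    then show ?thesis using g(1) by blast
  qed
qed

section \<open>Linear independence and dimension counts\<close>

lemma monomial_fun_independent:
  fixes c :: "'g \<Rightarrow> 'a::field"
  assumes "infinite (UNIV :: 'a set)" "finite D" "finite G"
    and "\<And>g h. g \<in> G \<Longrightarrow> h \<in> G \<Longrightarrow> (\<And>k. k \<in> D \<Longrightarrow> \<alpha> g k = \<alpha> h k) \<Longrightarrow> g = h"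
    and "\<And>u. (\<Sum>g\<in>G. c g * monomial_fun D (\<alpha> g) u) = 0" and "g \<in> G"
  shows "c g = 0"
  using assms(2-)
proof (induction D arbitrary: G g rule: finite_induct)
  case empty
  then have "G = {g}" by blast
  then show ?case using empty.prems by (simp add: monomial_fun_def)
next
  case (insert k D)
  let ?e = "\<alpha> g k"
  show ?case
  proof (rule insert.IH[of "{h\<in>G. \<alpha> h k = ?e}"])
    fix u :: "'b \<Rightarrow> 'a"
    \<comment> \<open>Only the coordinate \<open>k\<close> varies. As a polynomial in
      \<open>\<tau>\<close> the relation vanishes identically, and its coefficient at
      \<open>?e\<close> is a relation in one variable fewer between the monomials with that
      exponent.\<close>
    define p where "p = (\<Sum>h\<in>G. Polynomial.monom (c h * monomial_fun D (\<alpha> h) u) (\<alpha> h k))"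
    have "poly p \<tau> = 0" for \<tau>
    proof -
      have "monomial_fun (insert k D) \<beta> (u(k := \<tau>)) = \<tau> ^ \<beta> k * monomial_fun D \<beta> u" for \<beta>
      proof -
        have "(\<Prod>j\<in>D. (u(k := \<tau>)) j ^ \<beta> j) = (\<Prod>j\<in>D. u j ^ \<beta> j)"
          using insert.hyps by (intro prod.cong) auto
        then show ?thesis using insert.hyps by (simp add: monomial_fun_def)
      qed
      then show ?thesis
        using insert.prems(3)[of "u(k := \<tau>)"] unfolding p_def
        by (simp add: poly_sum poly_monom mult_ac del: fun_upd_apply)
    qed
    then have "p = 0" using assms(1) poly_roots_finite[of p] by auto
    then have "Polynomial.coeff p ?e = 0" by simp
    then show "(\<Sum>h\<in>{h\<in>G. \<alpha> h k = ?e}. c h * monomial_fun D (\<alpha> h) u) = 0"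
      using insert.prems(1)
      by (simp add: p_def coeff_sum if_distrib sum.inter_filter cong: if_cong)
    show "g' = h" if "g' \<in> {h\<in>G. \<alpha> h k = ?e}" "h \<in> {h\<in>G. \<alpha> h k = ?e}"
      "\<And>j. j \<in> D \<Longrightarrow> \<alpha> g' j = \<alpha> h j" for g' h
      using that by (intro insert.prems(2)) auto
  qed (use insert.prems in auto)
qed

text \<open>Independence is assumed for the indexed family and so includes injectivity of
  \<open>h\<close>; this allows counting indices instead of vectors.\<close>

lemma card_le_card_spanning:
  fixes h :: "'p \<Rightarrow> 'b \<Rightarrow> 'a::field"
  assumes "finite P" "finite T" "h ` P \<subseteq> fn.span T"
    and ind: "\<And>c p. (\<And>x. (\<Sum>p\<in>P. c p * h p x) = 0) \<Longrightarrow> p \<in> P \<Longrightarrow> c p = 0"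
  shows "card P \<le> card T"
proof -
  have inj: "inj_on h P"
  proof (rule inj_onI, rule ccontr)
    fix p p' assume p: "p \<in> P" "p' \<in> P" "h p = h p'" "p \<noteq> p'"
    have "(if p = p then 1 else if p = p' then - 1 else 0) = (0 :: 'a)"
    proof (rule ind[of "\<lambda>q. if q = p then 1 else if q = p' then - 1 else 0"])
      fix x
      have "(\<Sum>q\<in>P. (if q = p then 1 else if q = p' then - 1 else 0) * h q x)
          = (\<Sum>q\<in>P. (if q = p then h q x else 0) + (if q = p' then - h q x else 0))"
        using p by (intro sum.cong) auto
      also have "\<dots> = 0" using p assms(1) by (simp add: sum.distrib)
      finally show "(\<Sum>q\<in>P. (if q = p then 1 else if q = p' then - 1 else 0) * h q x) = 0" .
    qed (use p in auto)
    then show False by simp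
  qed
  have "fn.independent (h ` P)"
    unfolding fn.dependent_finite[OF finite_imageI[OF assms(1)]]
  proof (rule notI, elim exE conjE bexE)
    fix u v assume v: "v \<in> h ` P" "u v \<noteq> 0" and u: "(\<Sum>v\<in>h ` P. (\<lambda>x. u v * v x)) = 0"
    from v obtain p where p: "p \<in> P" "v = h p" by blast
    have "(\<Sum>p\<in>P. u (h p) * h p x) = 0" for x
      using fun_cong[OF u, of x] inj by (simp add: sum_fun_apply sum.reindex)
    from ind[of "\<lambda>p. u (h p)", OF this p(1)] p(2) v(2) show False by simp
  qed
  then have "card (h ` P) \<le> card T"
    using fn.independent_span_bound[OF assms(2) _ assms(3)] by simp
  then show ?thesis using inj by (simp add: card_image)
qed

lemma card_monomial_funs_le:
  assumes "finite D"
  shows "finite {monomial_fun D \<alpha> :: ('i \<Rightarrow> 'a::field) \<Rightarrow> 'a |\<alpha>. \<forall>k\<in>D. \<alpha> k \<le> N}"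
    and "card {monomial_fun D \<alpha> :: ('i \<Rightarrow> 'a::field) \<Rightarrow> 'a |\<alpha>. \<forall>k\<in>D. \<alpha> k \<le> N} \<le> (N + 1) ^ card D"
proof -
  have sub: "{monomial_fun D \<alpha> :: ('i \<Rightarrow> 'a::field) \<Rightarrow> 'a |\<alpha>. \<forall>k\<in>D. \<alpha> k \<le> N}
      \<subseteq> monomial_fun D ` (D \<rightarrow>\<^sub>E {..N})"
  proof clarify
    fix \<alpha> assume "\<forall>k\<in>D. \<alpha> k \<le> N"
    then have "restrict \<alpha> D \<in> D \<rightarrow>\<^sub>E {..N}" by auto
    moreover have "monomial_fun D \<alpha> = (monomial_fun D (restrict \<alpha> D) :: ('i \<Rightarrow> 'a::field) \<Rightarrow> 'a)"
      by (auto simp: monomial_fun_def fun_eq_iff intro!: prod.cong)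
    ultimately show "(monomial_fun D \<alpha> :: ('i \<Rightarrow> 'a::field) \<Rightarrow> 'a) \<in> monomial_fun D ` (D \<rightarrow>\<^sub>E {..N})"
      by blast
  qed
  have fin: "finite (D \<rightarrow>\<^sub>E {..N})" using assms by (intro finite_PiE) auto
  show "finite {monomial_fun D \<alpha> :: ('i \<Rightarrow> 'a::field) \<Rightarrow> 'a |\<alpha>. \<forall>k\<in>D. \<alpha> k \<le> N}"
    using finite_subset[OF sub] fin by blast
  have "card {monomial_fun D \<alpha> :: ('i \<Rightarrow> 'a::field) \<Rightarrow> 'a |\<alpha>. \<forall>k\<in>D. \<alpha> k \<le> N} \<le> card (D \<rightarrow>\<^sub>E {..N})"
    using card_mono[OF finite_imageI[OF fin] sub] card_image_le[OF fin] by (rule order.trans)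
  then show "card {monomial_fun D \<alpha> :: ('i \<Rightarrow> 'a::field) \<Rightarrow> 'a |\<alpha>. \<forall>k\<in>D. \<alpha> k \<le> N} \<le> (N + 1) ^ card D"
    using assms by (simp add: card_PiE)
qed


section \<open>Separating polynomials and jets at the solutions\<close>

lemma polybox_mult:
  assumes "f \<in> polybox K M" "g \<in> polybox K N"
  shows "(\<lambda>x. f x * g x) \<in> polybox K (\<lambda>k. M k + N k)"
proof (rule span_mult_closed[OF subspace_polybox assms(2)[unfolded polybox_def]])
  fix h :: "('a \<Rightarrow> 'b) \<Rightarrow> 'b" assume "h \<in> {monomial_fun K \<alpha> |\<alpha>. \<forall>k\<in>K. \<alpha> k \<le> N k}"
  then obtain \<beta> where \<beta>: "h = monomial_fun K \<beta>" "\<forall>k\<in>K. \<beta> k \<le> N k" by auto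
  have "(\<lambda>x. h x * f x) \<in> polybox K (\<lambda>k. M k + N k)"
  proof (rule span_mult_closed[OF subspace_polybox assms(1)[unfolded polybox_def]])
    fix h' :: "('a \<Rightarrow> 'b) \<Rightarrow> 'b" assume "h' \<in> {monomial_fun K \<alpha> |\<alpha>. \<forall>k\<in>K. \<alpha> k \<le> M k}"
    then obtain \<alpha> where \<alpha>: "h' = monomial_fun K \<alpha>" "\<forall>k\<in>K. \<alpha> k \<le> M k" by auto
    have "(\<lambda>x. h x * h' x) = monomial_fun K (\<lambda>k. \<alpha> k + \<beta> k)"
      by (simp add: \<alpha>(1) \<beta>(1) monomial_fun_def power_add prod.distrib mult.commute fun_eq_iff)
    then show "(\<lambda>x. h x * h' x) \<in> polybox K (\<lambda>k. M k + N k)"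
      using \<alpha>(2) \<beta>(2) by (auto intro!: monomial_fun_in_polybox add_mono)
  qed
  then show "(\<lambda>x. f x * h x) \<in> polybox K (\<lambda>k. M k + N k)"
    by (simp add: mult.commute)
qed

lemma polybox_const: "(\<lambda>_. c) \<in> polybox K N"
  using polybox_scale[OF monomial_fun_in_polybox[of K "\<lambda>_. 0" N], of c] by (simp add: monomial_fun_def)

lemma polybox_prod:
  assumes "finite S" "\<And>w. w \<in> S \<Longrightarrow> f w \<in> polybox K (\<lambda>_. N)"
  shows "(\<lambda>x. \<Prod>w\<in>S. f w x) \<in> polybox K (\<lambda>_. card S * N)"
  using assms
proof (induction S rule: finite_induct)
  case (insert w S)
  then show ?case
    using polybox_mult[of "f w" K "\<lambda>_. N" "\<lambda>x. \<Prod>w\<in>S. f w x" "\<lambda>_. card S * N"] by simp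
qed (simp add: polybox_const)

lemma polybox_linear:
  assumes "finite K" "k \<in> K"
  shows "(\<lambda>x. x k - c) \<in> polybox K (\<lambda>_. 1)"
proof -
  have "(\<lambda>x. \<Prod>j\<in>K. poly (if j = k then [:- c, 1:] else 1) (x j)) \<in> polybox K (\<lambda>_. 1)"
    using assms(1) by (intro prod_poly_in_polybox) auto
  also have "(\<lambda>x. \<Prod>j\<in>K. poly (if j = k then [:- c, 1:] else 1) (x j)) = (\<lambda>x. x k - c)"
  proof
    fix x
    have "(\<Prod>j\<in>K - {k}. poly (if j = k then [:- c, 1:] else 1) (x j)) = 1"
      by (intro prod.neutral) auto
    then show "(\<Prod>j\<in>K. poly (if j = k then [:- c, 1:] else 1) (x j)) = x k - c"
      using assms by (simp add: prod.remove[of K k])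
  qed
  finally show ?thesis .
qed

lemma vanishes_to_order_1:
  assumes "f \<in> polybox K N" "f v = 0"
  shows "vanishes_to_order {v} 1 f"
  unfolding vanishes_to_order_def
proof (intro ballI allI)
  fix w u assume "w \<in> {v}"
  then have w: "w = v" by simp
  obtain p where p: "\<And>\<tau>. f (\<lambda>k. v k + \<tau> * u k) = poly p \<tau>"
    using vanishes_to_order_polybox[OF assms(1), of "{v}"] unfolding vanishes_to_order_def by force
  have "poly p 0 = 0" using p[of 0] assms(2) by simp
  then obtain r where "p = [:0, 1:] * r"
    by (metis dvdE poly_eq_0_iff_dvd neg_equal_0_iff_equal)
  then show "\<exists>r. \<forall>\<tau>. f (\<lambda>k. w k + \<tau> * u k) = \<tau> ^ 1 * poly r \<tau>"
    by (intro exI[of _ r]) (simp add: p w)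
qed

lemma vanishes_to_order_power:
  assumes "vanishes_to_order V 1 f"
  shows "vanishes_to_order V n (\<lambda>x. f x ^ n)"
proof (induction n)
  case 0
  show ?case unfolding vanishes_to_order_def by (auto intro!: exI[of _ 1])
next
  case (Suc n)
  then show ?case using vanishes_to_order_mult[OF assms Suc] by simp
qed

text \<open>For each other point \<open>w\<close> choose a coordinate in which it differs from
  \<open>v\<close>, and multiply the corresponding linear forms, scaled to be 1 at
  \<open>v\<close>.\<close>

lemma separating_polynomial:
  fixes V :: "('i \<Rightarrow> 'a::field) set"
  assumes "finite V" "finite D"
    and sep: "\<And>w. w \<in> V \<Longrightarrow> w \<noteq> v \<Longrightarrow> \<exists>k\<in>D. w k \<noteq> v k"
  shows "\<exists>Q\<in>polybox D (\<lambda>_. card V). Q v = 1 \<and> (\<forall>w\<in>V. w \<noteq> v \<longrightarrow> Q w = 0)"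
proof -
  have "\<forall>w\<in>V - {v}. \<exists>k\<in>D. w k \<noteq> v k" using sep by blast
  then obtain \<kappa> where \<kappa>: "\<And>w. w \<in> V - {v} \<Longrightarrow> \<kappa> w \<in> D" "\<And>w. w \<in> V - {v} \<Longrightarrow> w (\<kappa> w) \<noteq> v (\<kappa> w)"
    by metis
  define Q where "Q x = (\<Prod>w\<in>V - {v}. inverse (v (\<kappa> w) - w (\<kappa> w)) * (x (\<kappa> w) - w (\<kappa> w)))" for x
  have "Q \<in> polybox D (\<lambda>_. card (V - {v}) * 1)"
    unfolding Q_def
  proof (rule polybox_prod)
    show "finite (V - {v})" using assms(1) by simp
    fix w assume "w \<in> V - {v}"
    then show "(\<lambda>x. inverse (v (\<kappa> w) - w (\<kappa> w)) * (x (\<kappa> w) - w (\<kappa> w))) \<in> polybox D (\<lambda>_. 1)"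
      by (intro polybox_scale polybox_linear assms(2) \<kappa>(1))
  qed
  moreover have "card (V - {v}) \<le> card V" using assms(1) by (intro card_mono) auto
  ultimately have "Q \<in> polybox D (\<lambda>_. card V)"
    using polybox_mono[of D "\<lambda>_. card (V - {v}) * 1" "\<lambda>_. card V"] by auto
  moreover have "Q v = 1"
    unfolding Q_def by (intro prod.neutral ballI) (use \<kappa>(2) in force)
  moreover have "Q w = 0" if "w \<in> V" "w \<noteq> v" for w
    unfolding Q_def by (intro prod_zero bexI[of _ w]) (use that assms(1) in auto)
  ultimately show ?thesis by blast
qed

lemma poly_eqI_infinite:
  fixes p q :: "'a::field poly"
  assumes "infinite (UNIV :: 'a set)" "\<And>x. poly p x = poly q x"
  shows "p = q"
  using poly_roots_finite[of "p - q"] assms by auto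

text \<open>The left side counts the jets of order below \<open>L\<close> at the points of
  \<open>V\<close>, the right side bounds the dimension of the box \<open>L + d\<close>. Reduction
  modulo order \<open>L\<close> moves the jets into that box and keeps them linearly
  independent.\<close>

lemma card_solutions_mult_le:
  fixes a :: "'j \<Rightarrow> nat \<Rightarrow> 'a::field"
  assumes K: "infinite (UNIV :: 'a set)" and d: "d > 0" "finite I" "card I = d"
    and inj: "\<And>k. k < d \<Longrightarrow> inj_on (\<lambda>i. a i k) I"
    and V: "finite V" "\<And>v i. v \<in> V \<Longrightarrow> i \<in> I \<Longrightarrow> (\<Prod>k<d. v k - a i k) = b i"
    and sep: "\<And>v w. v \<in> V \<Longrightarrow> w \<in> V \<Longrightarrow> (\<And>k. k < d \<Longrightarrow> v k = w k) \<Longrightarrow> v = w"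
    and L: "L > 0"
  shows "card V * ((L - 1 + d) choose d) \<le> (L + d + 1) ^ d"
proof -
  \<comment> \<open>The first \<open>d\<close> entries are the exponents of a monomial of degree below \<open>L\<close>, the last one fills up the sum.\<close>
  define G where "G = {l :: nat list. length l = d + 1 \<and> sum_list l = L - 1}"
  have card_G: "card G = (L - 1 + d) choose d"
    unfolding G_def card_length_sum_list using binomial_symmetric[of d "L - 1 + d"] by simp
  have "card G > 0" unfolding card_G by simp
  then have fin_G: "finite G" by (rule card_ge_0_finite)
  have sum_G: "(\<Sum>k<d. l ! k) + l ! d = L - 1" if "l \<in> G" for l
    using that by (auto simp: G_def sum_list_sum_nth atLeast0LessThan)
  obtain Q where Q: "\<And>v. v \<in> V \<Longrightarrow> Q v \<in> polybox {..<d} (\<lambda>_. card V)" "\<And>v. v \<in> V \<Longrightarrow> Q v v = 1"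
    "\<And>v w. v \<in> V \<Longrightarrow> w \<in> V \<Longrightarrow> w \<noteq> v \<Longrightarrow> Q v w = 0"
  proof -
    have "\<forall>v\<in>V. \<exists>Q\<in>polybox {..<d} (\<lambda>_. card V). Q v = 1 \<and> (\<forall>w\<in>V. w \<noteq> v \<longrightarrow> Q w = 0)"
      by (intro ballI separating_polynomial) (use V(1) sep in \<open>auto intro: lessThan_iff\<close>)
    then show thesis using that by metis
  qed
  \<comment> \<open>Jet number \<open>l\<close> at \<open>v\<close>: the factor \<open>Q v ^ L\<close> kills all jets at the other solutions.\<close>
  define H where "H p x = Q (fst p) x ^ L * (\<Prod>k<d. (x k - fst p k) ^ (snd p ! k))" for p x
  have prod_polybox: "(\<lambda>x. \<Prod>k<d. (x k - v k) ^ (l ! k)) \<in> polybox {..<d} (\<lambda>_. L)" if "l \<in> G" for v l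
  proof -
    have "l ! k \<le> L" if "k < d" for k
      using sum_G[OF \<open>l \<in> G\<close>] member_le_sum[of k "{..<d}" "\<lambda>k. l ! k"] that by simp
    then have "(\<lambda>x. \<Prod>k<d. poly ([:- v k, 1:] ^ (l ! k)) (x k)) \<in> polybox {..<d} (\<lambda>_. L)"
      by (intro prod_poly_in_polybox) (auto intro!: order.trans[OF degree_power_le])
    then show ?thesis by simp
  qed
  have Qpow: "(\<lambda>x. Q v x ^ L) \<in> polybox {..<d} (\<lambda>_. L * card V)" if "v \<in> V" for v
    using polybox_prod[of "{..<L}" "\<lambda>_. Q v" "{..<d}" "card V"] Q(1)[OF that] by simp
  have "\<exists>g\<in>polybox {..<d} (\<lambda>_. L + card {..<d}). vanishes_to_order V L (H p - g)" if "p \<in> V \<times> G" for p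
  proof (rule polybox_reduce_to_fixed_degree)
    show "H p \<in> polybox {..<d} (\<lambda>_. L * card V + L)"
      unfolding H_def using that by (intro polybox_mult Qpow prod_polybox) auto
  qed (use d inj V in auto)
  then obtain g where g: "\<And>p. p \<in> V \<times> G \<Longrightarrow> g p \<in> polybox {..<d} (\<lambda>_. L + d)"
    "\<And>p. p \<in> V \<times> G \<Longrightarrow> vanishes_to_order V L (H p - g p)"
    by (metis card_lessThan)
  let ?T = "{monomial_fun {..<d} \<alpha> :: (nat \<Rightarrow> 'a) \<Rightarrow> 'a |\<alpha>. \<forall>k\<in>{..<d}. \<alpha> k \<le> L + d}"
  have "card (V \<times> G) \<le> card ?T"
  proof (rule card_le_card_spanning)
    show "finite (V \<times> G)" using V(1) fin_G by blast
    show "finite ?T" by (rule card_monomial_funs_le) simp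
    show "g ` (V \<times> G) \<subseteq> fn.span ?T" using g(1) unfolding polybox_def by blast
    fix c p assume c: "\<And>x. (\<Sum>p\<in>V \<times> G. c p * g p x) = 0" and "p \<in> V \<times> G"
    then obtain v l where p: "p = (v, l)" "v \<in> V" "l \<in> G" by blast
    have sub: "fn.subspace {f. vanishes_to_order {v} L f}"
      by (rule subspace_vanishes_to_order)
    have "(\<Sum>p\<in>V \<times> G. (\<lambda>x. c p * (H p - g p) x)) \<in> {f. vanishes_to_order {v} L f}"
      by (intro fn.subspace_sum[OF sub] fn.subspace_scale[OF sub])
         (use g(2) p(2) in \<open>auto simp: vanishes_to_order_def\<close>)
    \<comment> \<open>The assumed relation cancels the reductions \<open>g p\<close>, so the same
      combination of the \<open>H p\<close> vanishes to order \<open>L\<close> at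
      \<open>v\<close>.\<close>
    also have "(\<Sum>p\<in>V \<times> G. (\<lambda>x. c p * (H p - g p) x)) = (\<lambda>x. \<Sum>p\<in>V \<times> G. c p * H p x)"
      using c by (simp add: fun_eq_iff sum_fun_apply algebra_simps sum_subtractf)
    also have "\<dots> = (\<lambda>x. \<Sum>l\<in>G. c (v, l) * H (v, l) x) + (\<Sum>p\<in>(V - {v}) \<times> G. (\<lambda>x. c p * H p x))"
    proof
      fix x
      have "(\<Sum>p\<in>V \<times> G. c p * H p x) = (\<Sum>w\<in>V. \<Sum>l\<in>G. c (w, l) * H (w, l) x)"
        by (simp add: sum.cartesian_product)
      also have "\<dots> = (\<Sum>l\<in>G. c (v, l) * H (v, l) x) + (\<Sum>w\<in>V - {v}. \<Sum>l\<in>G. c (w, l) * H (w, l) x)"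
        using V(1) p(2) by (rule sum.remove)
      finally show "(\<Sum>p\<in>V \<times> G. c p * H p x)
          = ((\<lambda>x. \<Sum>l\<in>G. c (v, l) * H (v, l) x) + (\<Sum>p\<in>(V - {v}) \<times> G. (\<lambda>x. c p * H p x))) x"
        by (simp add: sum.cartesian_product sum_fun_apply)
    qed
    finally have 1: "(\<lambda>x. \<Sum>l\<in>G. c (v, l) * H (v, l) x) + (\<Sum>p\<in>(V - {v}) \<times> G. (\<lambda>x. c p * H p x))
        \<in> {f. vanishes_to_order {v} L f}" .
    have 2: "(\<Sum>p\<in>(V - {v}) \<times> G. (\<lambda>x. c p * H p x)) \<in> {f. vanishes_to_order {v} L f}"
    proof (intro fn.subspace_sum[OF sub] fn.subspace_scale[OF sub] CollectI)
      fix p assume p': "p \<in> (V - {v}) \<times> G"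
      have "vanishes_to_order {v} (L + 0) (H p)"
        unfolding H_def
        by (intro vanishes_to_order_mult vanishes_to_order_power vanishes_to_order_1[OF Q(1)] Q(3)
              vanishes_to_order_polybox[OF prod_polybox]) (use p' p(2) in auto)
      then show "vanishes_to_order {v} L (H p)" by simp
    qed
    have "(\<lambda>x. \<Sum>l\<in>G. c (v, l) * H (v, l) x) \<in> {f. vanishes_to_order {v} L f}"
      using fn.subspace_diff[OF sub 1 2] by simp
    then have van: "vanishes_to_order {v} L (\<lambda>x. \<Sum>l\<in>G. c (v, l) * H (v, l) x)" by blast
    have "c (v, l) = 0"
    proof (rule monomial_fun_independent[OF K, of "{..<d}" G "\<lambda>l k. l ! k" "\<lambda>l. c (v, l)" l])
      fix l m assume lm: "l \<in> G" "m \<in> G" "\<And>k. k \<in> {..<d} \<Longrightarrow> l ! k = m ! k"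
      then have "(\<Sum>k<d. l ! k) = (\<Sum>k<d. m ! k)" by (intro sum.cong) auto
      then have "l ! d = m ! d" using sum_G[OF lm(1)] sum_G[OF lm(2)] by linarith
      with lm show "l = m"
        by (intro nth_equalityI) (auto simp: G_def less_Suc_eq)
    next
      fix u :: "nat \<Rightarrow> 'a"
      obtain r where r: "\<And>\<tau>. (\<Sum>l\<in>G. c (v, l) * H (v, l) (\<lambda>k. v k + \<tau> * u k)) = \<tau> ^ L * poly r \<tau>"
        using van unfolding vanishes_to_order_def by blast
      obtain q where q: "\<And>\<tau>. Q v (\<lambda>k. v k + \<tau> * u k) = poly q \<tau>"
        using vanishes_to_order_polybox[OF Q(1)[OF p(2)], of "{v}"] unfolding vanishes_to_order_def by force
      \<comment> \<open>Along the line through \<open>v\<close> in direction \<open>u\<close>, each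
        jet at \<open>v\<close> is \<open>q ^ L\<close> times its monomial at \<open>u\<close> times
        \<open>\<tau>\<close> to its degree. So \<open>S\<close> has degree below \<open>L\<close>,
        yet \<open>\<tau> ^ L\<close> divides \<open>q ^ L * S\<close>.\<close>
      define S where "S = (\<Sum>l\<in>G. Polynomial.monom (c (v, l) * monomial_fun {..<d} (\<lambda>k. l ! k) u) (\<Sum>k<d. l ! k))"
      have H: "H (v, l) (\<lambda>k. v k + \<tau> * u k)
          = poly q \<tau> ^ L * (\<tau> ^ (\<Sum>k<d. l ! k) * monomial_fun {..<d} (\<lambda>k. l ! k) u)" for l \<tau>
        by (simp add: H_def q monomial_fun_def power_mult_distrib prod.distrib power_sum)
      have "q ^ L * S = [:0, 1:] ^ L * r"
      proof (rule poly_eqI_infinite[OF K])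
        fix \<tau>
        have "poly (q ^ L * S) \<tau> = (\<Sum>l\<in>G. c (v, l) * H (v, l) (\<lambda>k. v k + \<tau> * u k))"
          by (simp add: S_def poly_sum poly_monom H sum_distrib_left mult_ac)
        then show "poly (q ^ L * S) \<tau> = poly ([:0, 1:] ^ L * r) \<tau>"
          by (simp add: r)
      qed
      then have dvd: "[:- 0, 1:] ^ L dvd q ^ L * S" by simp
      \<comment> \<open>As \<open>q\<close> does not vanish at 0, \<open>\<tau> ^ L\<close> divides
        \<open>S\<close> alone, which its degree allows only for \<open>S = 0\<close>.\<close>
      have q0: "poly q 0 \<noteq> 0" using q[of 0] Q(2)[OF p(2)] by simp
      have "S = 0"
      proof (rule ccontr)
        assume S: "S \<noteq> 0"
        then have nz: "q ^ L * S \<noteq> 0" using q0 by auto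
        have "Polynomial.order 0 (q ^ L) = 0" using q0 by (intro order_0I) simp
        then have "L \<le> Polynomial.order 0 S"
          using dvd nz order_divides[of 0 L "q ^ L * S"] by (auto simp: order_mult)
        also have "\<dots> \<le> Polynomial.degree S" by (rule order_degree[OF S])
        also have "\<dots> \<le> L - 1"
          unfolding S_def using sum_G
          by (intro degree_sum_le fin_G order.trans[OF degree_monom_le]) (metis le_add1)
        finally show False using L by simp
      qed
      \<comment> \<open>At \<open>\<tau> = 1\<close> the polynomial \<open>S\<close> becomes the
        relation between the monomials at \<open>u\<close>.\<close>
      then have "poly S 1 = 0" by simp
      then show "(\<Sum>l\<in>G. c (v, l) * monomial_fun {..<d} ((!) l) u) = 0"
        by (simp add: S_def poly_sum poly_monom)
    qed (use fin_G p in auto)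
    then show "c p = 0" using p by simp
  qed
  also have "card ?T \<le> (L + d + 1) ^ card {..<d}" by (rule card_monomial_funs_le) simp
  finally show ?thesis using card_G by (simp add: card_cartesian_product)
qed

text \<open>The right-hand side is the product of the \<open>d\<close> consecutive numbers from
  \<open>m + 1\<close> to \<open>m + d\<close>.\<close>

lemma power_le_fact_mult_choose: "Suc m ^ d \<le> fact d * ((m + d) choose d)"
proof -
  have "Suc m ^ d * fact m \<le> fact (m + d)"
  proof (induction d)
    case (Suc d)
    have "Suc m ^ Suc d * fact m \<le> Suc m * fact (m + d)"
      using mult_le_mono[OF order.refl Suc.IH, of "Suc m"] by (simp only: power_Suc mult.assoc)
    also have "\<dots> \<le> Suc (m + d) * fact (m + d)" by (intro mult_right_mono) auto
    finally show ?case by simp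
  qed simp
  also have "fact (m + d) = fact d * ((m + d) choose d) * (fact m :: nat)"
    using binomial_fact_lemma[of d "m + d"] by (simp add: mult_ac)
  finally show ?thesis by simp
qed

text \<open>Since \<open>L ^ d \<le> fact d * ((L - 1 + d) choose d)\<close>, the jet count bounds
  \<open>card V\<close> by \<open>fact d * ((L + d + 1) / L) ^ d\<close>, which tends to
  \<open>fact d\<close>.\<close>

theorem card_solutions_le_fact:
  fixes a :: "'j \<Rightarrow> nat \<Rightarrow> 'a::field"
  assumes K: "infinite (UNIV :: 'a set)" and d: "d > 0" "finite I" "card I = d"
    and inj: "\<And>k. k < d \<Longrightarrow> inj_on (\<lambda>i. a i k) I"
    and V: "finite V" "\<And>v i. v \<in> V \<Longrightarrow> i \<in> I \<Longrightarrow> (\<Prod>k<d. v k - a i k) = b i"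
    and sep: "\<And>v w. v \<in> V \<Longrightarrow> w \<in> V \<Longrightarrow> (\<And>k. k < d \<Longrightarrow> v k = w k) \<Longrightarrow> v = w"
  shows "card V \<le> fact d"
proof -
  have bound: "real (card V) \<le> fact d * (1 + (real d + 1) * inverse (real L)) ^ d" if "L > 0" for L
  proof -
    have "card V * L ^ d \<le> card V * (fact d * ((L - 1 + d) choose d))"
      using power_le_fact_mult_choose[of "L - 1" d] that by (intro mult_left_mono) simp_all
    also have "\<dots> = fact d * (card V * ((L - 1 + d) choose d))"
      by (simp add: mult_ac)
    also have "\<dots> \<le> fact d * (L + d + 1) ^ d"
      by (intro mult_left_mono card_solutions_mult_le[OF assms that]) simp_all
    finally have "real (card V * L ^ d) \<le> real (fact d * (L + d + 1) ^ d)"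
      by (rule of_nat_mono)
    then have "real (card V) * real L ^ d \<le> fact d * (real L + real d + 1) ^ d"
      by (simp add: add_ac)
    then have "real (card V) \<le> fact d * ((real L + real d + 1) / real L) ^ d"
      using that by (simp add: field_simps power_divide)
    also have "(real L + real d + 1) / real L = 1 + (real d + 1) * inverse (real L)"
      using that by (simp add: field_simps)
    finally show ?thesis .
  qed
  have "(\<lambda>L. fact d * (1 + (real d + 1) * inverse (real L)) ^ d) \<longlonglongrightarrow> fact d * (1 + (real d + 1) * 0) ^ d"
    by (intro tendsto_intros LIMSEQ_inverse_real_of_nat lim_inverse_n)
  then have "real (card V) \<le> fact d * (1 + (real d + 1) * 0) ^ d"
    by (rule LIMSEQ_le_const) (auto intro!: bound exI[of _ 1])
  then have "real (card V) \<le> real (fact d)" by simp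
  then show ?thesis by linarith
qed

subsection \<open>Regular graphs without a complete bipartite subgraph\<close>

text \<open>The link between relations on an arbitrary vertex type and \<open>rex\<close>:
  \<open>f\<close> renumbers the vertices, and each edge accounts for at most two of the
  \<open>card V * k\<close> arcs.\<close>

lemma rex_ge:
  fixes V :: "'v set" and R :: "('v \<times> 'v) set"
  assumes V: "finite V" and R: "R \<subseteq> V \<times> V" "sym R" "irrefl R"
    and deg: "\<And>v. v \<in> V \<Longrightarrow> card (R `` {v}) = k"
    and free: "\<And>A B. A \<subseteq> V \<Longrightarrow> B \<subseteq> V \<Longrightarrow> card A = s \<Longrightarrow> card B = t \<Longrightarrow> \<not> A \<times> B \<subseteq> R"
  shows "card V * k \<le> 2 * rex (card V) (complete_bipartite s t)"
proof -
  obtain f where f: "bij_betw f V {..<card V}"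
    using ex_bij_betw_finite_nat[OF V] by (auto simp: atLeast0LessThan)
  have inj: "inj_on f V" using f by (rule bij_betw_imp_inj_on)
  define G :: "nat pair_pre_digraph" where
    "G = \<lparr> pverts = {..<card V}, parcs = (\<lambda>(u, v). (f u, f v)) ` R \<rparr>"
  have finR: "finite R" using finite_subset[OF R(1)] V by simp
  have arcsI: "(f u, f v) \<in> parcs G" if "(u, v) \<in> R" for u v
    using that by (auto simp: G_def)
  have arcsD: "(u, v) \<in> R" if "(f u, f v) \<in> parcs G" "u \<in> V" "v \<in> V" for u v
  proof -
    from that(1) obtain u' v' where uv: "(u', v') \<in> R" "f u = f u'" "f v = f v'"
      by (auto simp: G_def)
    then have "u' \<in> V" "v' \<in> V" using R(1) by auto
    then show ?thesis using uv that(2,3) inj by (metis inj_onD)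
  qed
  have arcsE: "\<exists>u v. e = (f u, f v) \<and> (u, v) \<in> R" if "e \<in> parcs G" for e
    using that by (auto simp: G_def)
  have fV: "f v < card V" if "v \<in> V" for v
    using bij_betwE[OF f] that by auto
  have graph: "pair_graph G"
  proof
    show "finite (pverts G)" by (simp add: G_def)
    show "finite (parcs G)" using finR by (simp add: G_def)
    show "fst e \<in> pverts G" "snd e \<in> pverts G" if "e \<in> parcs G" for e
      using arcsE[OF that] R(1) fV by (auto simp: G_def)
    show "fst e \<noteq> snd e" if e: "e \<in> parcs G" for e
    proof -
      obtain u v where uv: "e = (f u, f v)" "(u, v) \<in> R" using arcsE[OF e] by blast
      then have "u \<noteq> v" "u \<in> V" "v \<in> V" using R(1,3) by (auto simp: irrefl_def)
      then show ?thesis using uv(1) inj by (auto dest: inj_onD)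
    qed
    have "sym (parcs G)"
    proof (rule symI)
      fix x y assume "(x, y) \<in> parcs G"
      then obtain u v where "(u, v) \<in> R" "x = f u" "y = f v" using arcsE by blast
      then show "(y, x) \<in> parcs G" using arcsI symD[OF R(2)] by blast
    qed
    then show "symmetric (with_proj G)"
      by (simp add: symmetric_def)
  qed
  interpret G: pair_graph G by (rule graph)
  have reg: "regular_graph G"
    unfolding regular_graph_def
  proof (intro exI ballI)
    fix x assume "x \<in> pverts G"
    then obtain v where v: "v \<in> V" "x = f v"
      using f by (auto simp: G_def bij_betw_def)
    have "out_arcs (with_proj G) x = (\<lambda>w. (f v, f w)) ` (R `` {v})"
    proof (intro equalityI subsetI)
      fix e assume "e \<in> out_arcs (with_proj G) x"
      then have e: "e \<in> parcs G" "fst e = f v" using v by (auto simp: out_arcs_def)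
      then obtain u w where uw: "e = (f u, f w)" "(u, w) \<in> R" using arcsE by blast
      then have "u \<in> V" using R(1) by blast
      then have "u = v" using uw e v inj by (auto dest: inj_onD)
      then show "e \<in> (\<lambda>w. (f v, f w)) ` (R `` {v})" using uw by blast
    next
      fix e assume "e \<in> (\<lambda>w. (f v, f w)) ` (R `` {v})"
      then obtain w where "(v, w) \<in> R" "e = (f v, f w)" by blast
      then show "e \<in> out_arcs (with_proj G) x" using arcsI v by (simp add: out_arcs_def)
    qed
    moreover have "inj_on (\<lambda>w. (f v, f w)) (R `` {v})"
      using inj R(1) by (auto simp: inj_on_def)
    ultimately show "out_degree (with_proj G) x = k"
      using deg[OF v(1)] by (simp add: out_degree_def card_image)
  qed
  have nocopy: "\<not> contains_copy G (complete_bipartite s t)"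
  proof
    assume "contains_copy G (complete_bipartite s t)"
    then obtain H h where H: "subgraph (with_proj H) (with_proj G)"
      and iso: "pre_digraph.digraph_isomorphism (with_proj (complete_bipartite s t)) h"
      and Hh: "with_proj H = app_iso h (with_proj (complete_bipartite s t))"
      by (auto simp: contains_copy_def digraph_iso_def)
    have isoD: "\<forall>a\<in>arcs (with_proj (complete_bipartite s t)).
        iso_verts h (fst a) = iso_tail h (iso_arcs h a) \<and> iso_verts h (snd a) = iso_head h (iso_arcs h a)"
      using iso unfolding pre_digraph.digraph_isomorphism_def by simp
    define g where "g = iso_verts h"
    have g_inj: "inj_on g ({..<s} <+> {..<t})"
      using iso by (simp add: pre_digraph.digraph_isomorphism_def g_def complete_bipartite_def)
    have pv: "pverts H = g ` ({..<s} <+> {..<t})"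
      using arg_cong[OF Hh, of verts] by (simp add: g_def complete_bipartite_def)
    have sub: "pverts H \<subseteq> {..<card V}" "parcs H \<subseteq> parcs G"
      using H by (auto simp: subgraph_def G_def)
    have arc: "(g (Inl i), g (Inr j)) \<in> parcs G" if "i < s" "j < t" for i j
    proof -
      let ?e = "(Inl i, Inr j) :: (nat + nat) \<times> (nat + nat)"
      have e: "?e \<in> arcs (with_proj (complete_bipartite s t))"
        using that by (simp add: complete_bipartite_def)
      then have "iso_arcs h ?e \<in> parcs H"
        using arg_cong[OF Hh, of arcs] by auto
      moreover have "iso_tail h = fst" "iso_head h = snd"
        using arg_cong[OF Hh, of tail] arg_cong[OF Hh, of head] by simp_all
      then have "fst (iso_arcs h ?e) = g (Inl i)" "snd (iso_arcs h ?e) = g (Inr j)"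
        using bspec[OF isoD e] by (simp_all add: g_def)
      ultimately show ?thesis using sub(2) by (metis prod.collapse subsetD)
    qed
    \<comment> \<open>The two sides of the copy, pulled back along \<open>f\<close>.\<close>
    define A where "A = {v\<in>V. \<exists>i<s. f v = g (Inl i)}"
    define B where "B = {v\<in>V. \<exists>j<t. f v = g (Inr j)}"
    have "f ` A = (\<lambda>i. g (Inl i)) ` {..<s}"
    proof -
      have "\<exists>v\<in>V. f v = g (Inl i)" if "i < s" for i
      proof -
        have "g (Inl i) \<in> f ` V" using sub(1) that pv f by (auto simp: bij_betw_def)
        then show ?thesis by force
      qed
      then show ?thesis unfolding A_def by force
    qed
    moreover have "f ` B = (\<lambda>j. g (Inr j)) ` {..<t}"
    proof -
      have "\<exists>v\<in>V. f v = g (Inr i)" if "i < t" for i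
      proof -
        have "g (Inr i) \<in> f ` V" using sub(1) that pv f by (auto simp: bij_betw_def)
        then show ?thesis by force
      qed
      then show ?thesis unfolding B_def by force
    qed
    moreover have "inj_on (\<lambda>i. g (Inl i)) {..<s}" "inj_on (\<lambda>j. g (Inr j)) {..<t}"
      using g_inj by (auto simp: inj_on_def)
    moreover have "inj_on f A" "inj_on f B"
      using inj by (auto simp: A_def B_def intro: inj_on_subset)
    ultimately have "card A = s" "card B = t"
      by (metis card_image card_lessThan)+
    moreover have "A \<subseteq> V" "B \<subseteq> V" by (auto simp: A_def B_def)
    moreover have "A \<times> B \<subseteq> R"
      using arc by (auto simp: A_def B_def intro!: arcsD)
    ultimately show False using free by blast
  qed
  have pairs: "{(x, y). {x, y} = {u, v}} = {(u, v), (v, u)}" for u v :: nat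
    by (auto simp: doubleton_eq_iff)
  have cand: "G \<in> rex_candidates (card V) (complete_bipartite s t)"
    using graph reg nocopy by (simp add: rex_candidates_def G_def)
  have "card V * k = (\<Sum>v\<in>V. card (R `` {v}))"
    using deg by simp
  also have "\<dots> = card (SIGMA v:V. R `` {v})"
    using V finR by (intro card_SigmaI[symmetric]) (auto intro: finite_Image)
  also have "(SIGMA v:V. R `` {v}) = R" using R(1) by auto
  also have "card R = card (parcs G)"
  proof -
    have "inj_on (map_prod f f) (V \<times> V)" using inj by (intro map_prod_inj_on)
    then have "inj_on (map_prod f f) R" using R(1) by (rule inj_on_subset)
    moreover have "parcs G = map_prod f f ` R" by (auto simp: G_def)
    ultimately show ?thesis by (simp add: card_image)
  qed
  also have "\<dots> \<le> card (\<Union>e\<in>edge_set G. {(x, y). {x, y} = e})"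
  proof (rule card_mono)
    show "finite (\<Union>e\<in>edge_set G. {(x, y). {x, y} = e})"
    proof (rule finite_UN_I)
      show "finite (edge_set G)" by (simp add: edge_set_def)
      show "finite {(x, y). {x, y} = e}" if e: "e \<in> edge_set G" for e
      proof -
        obtain u v where "e = {u, v}" using e by (auto simp: edge_set_def)
        then show ?thesis by (simp only: pairs) simp
      qed
    qed
    show "parcs G \<subseteq> (\<Union>e\<in>edge_set G. {(x, y). {x, y} = e})"
    proof
      fix p assume p: "p \<in> parcs G"
      obtain u v where uv: "p = (u, v)" by (cases p)
      have "{u, v} \<in> edge_set G"
        unfolding edge_set_def by (rule image_eqI[OF _ p]) (simp add: uv)
      then show "p \<in> (\<Union>e\<in>edge_set G. {(x, y). {x, y} = e})"
        by (rule UN_I) (simp add: uv)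
    qed
  qed
  also have "\<dots> \<le> (\<Sum>e\<in>edge_set G. card {(x, y). {x, y} = e})"
    by (rule card_UN_le) (simp add: edge_set_def)
  also have "\<dots> \<le> (\<Sum>e\<in>edge_set G. 2)"
  proof (rule sum_mono)
    fix e assume "e \<in> edge_set G"
    then obtain u v where e: "e = {u, v}" by (auto simp: edge_set_def)
    have "card {(x, y). {x, y} = e} = card {(u, v), (v, u)}"
      by (simp only: e pairs)
    also have "\<dots> \<le> 2"
      using card_length[of "[(u, v), (v, u)]"] by (simp only: list.set list.size)
    finally show "card {(x, y). {x, y} = e} \<le> 2" .
  qed
  also have "\<dots> = 2 * card (edge_set G)" by simp
  also have "card (edge_set G) \<le> rex (card V) (complete_bipartite s t)"
    unfolding rex_def using cand by (intro Max_ge finite_rex_values) auto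
  finally show ?thesis by simp
qed

subsection \<open>Cloning vertices of a bipartite graph\<close>

text \<open>
  The vertices \<open>(x, 0)\<close> and \<open>(x, 1)\<close> form the two sides, \<open>\<alpha> w\<close> is the perfect matching with label \<open>w\<close>. The
  clone \<open>(z, 2)\<close> of the left vertex \<open>z\<close> sees \<open>\<gamma> w z\<close> on the right, the clone \<open>(z, 3)\<close> of a right vertex sees
  \<open>\<beta> w z\<close> on the left. For \<open>z \<in> M\<close> both clones are identified with \<open>(z, 2)\<close> and only the labels in \<open>W1\<close> are used.
\<close>

locale clone_surgery =
  fixes Y :: "'x set" and W W1 :: "'w set" and \<alpha> \<beta> \<gamma> :: "'w \<Rightarrow> 'x \<Rightarrow> 'x" and Z M :: "'x set"
  assumes fin: "finite Y" "finite W" and half: "W1 \<subseteq> W" "card W = 2 * card W1"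
    and sub: "Z \<subseteq> Y" "M \<subseteq> Z"
    and bij: "\<And>w. w \<in> W \<Longrightarrow> bij_betw (\<alpha> w) Y Y" "\<And>w. w \<in> W \<Longrightarrow> bij_betw (\<beta> w) Y Y"
    and \<gamma>: "\<And>w x. w \<in> W \<Longrightarrow> x \<in> Y \<Longrightarrow> \<gamma> w x = \<alpha> w (\<beta> w x)"
    and neq: "\<And>x. x \<in> Y \<Longrightarrow> inj_on (\<lambda>w. \<alpha> w x) W" "\<And>x. x \<in> Y \<Longrightarrow> inj_on (\<lambda>w. \<beta> w x) W"
      "\<And>x. x \<in> Y \<Longrightarrow> inj_on (\<lambda>w. \<gamma> w x) W"
begin

definition idx :: "'x \<Rightarrow> 'w set" where
  "idx z = (if z \<in> M then W1 else W)"

definition right_clone :: "'x \<Rightarrow> 'x \<times> nat" where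
  "right_clone z = (z, if z \<in> M then 2 else 3)"

definition clone_verts :: "('x \<times> nat) set" where
  "clone_verts = Y \<times> {0, 1} \<union> Z \<times> {2} \<union> (Z - M) \<times> {3}"

text \<open>Arcs go from left to right; the graph is their union with the converse. The base edge
  removed for \<open>z\<close> and \<open>w\<close> joins \<open>\<beta> w z\<close> to
  \<open>\<alpha> w (\<beta> w z) = \<gamma> w z\<close>, the neighbours that the two clones
  attached to \<open>z\<close> receive along \<open>w\<close>, so each end trades one neighbour for
  a clone.\<close>

definition clone_arcs :: "(('x \<times> nat) \<times> ('x \<times> nat)) set" where
  "clone_arcs = {((x, 0), (\<alpha> w x, 1)) |x w. x \<in> Y \<and> w \<in> W \<and> \<not> (\<exists>z\<in>Z. w \<in> idx z \<and> \<beta> w z = x)}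
     \<union> {((z, 2), (\<gamma> w z, 1)) |z w. z \<in> Z \<and> w \<in> idx z}
     \<union> {((\<beta> w z, 0), right_clone z) |z w. z \<in> Z \<and> w \<in> idx z}"

lemma idx_subset: "idx z \<subseteq> W"
  using half by (auto simp: idx_def)

lemma maps: "w \<in> W \<Longrightarrow> x \<in> Y \<Longrightarrow> \<alpha> w x \<in> Y" "w \<in> W \<Longrightarrow> x \<in> Y \<Longrightarrow> \<beta> w x \<in> Y"
    "w \<in> W \<Longrightarrow> x \<in> Y \<Longrightarrow> \<gamma> w x \<in> Y"
  using bij[THEN bij_betwE] \<gamma> by simp_all

lemma finite_clone_verts: "finite clone_verts"
proof -
  have "finite Z" using sub(1) fin(1) by (rule finite_subset)
  then show ?thesis using fin by (auto simp: clone_verts_def)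
qed

lemma card_clone_verts: "card clone_verts + card M = 2 * card Y + 2 * card Z"
proof -
  have Z: "finite Z" and M: "finite M"
    using finite_subset[OF sub(1) fin(1)] finite_subset[OF sub(2)] by simp_all
  have "card clone_verts = card (Y \<times> {0::nat, 1}) + card (Z \<times> {2::nat}) + card ((Z - M) \<times> {3::nat})"
  proof -
    have "card (Y \<times> {0::nat, 1} \<union> Z \<times> {2}) = card (Y \<times> {0::nat, 1}) + card (Z \<times> {2::nat})"
      using fin Z by (intro card_Un_disjoint) auto
    moreover have "card (Y \<times> {0::nat, 1} \<union> Z \<times> {2} \<union> (Z - M) \<times> {3})
        = card (Y \<times> {0::nat, 1} \<union> Z \<times> {2}) + card ((Z - M) \<times> {3::nat})"
      using fin Z by (intro card_Un_disjoint) auto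
    ultimately show ?thesis by (simp only: clone_verts_def)
  qed
  moreover have "card (Z - M) + card M = card Z"
    using sub(2) M Z by (metis card_Diff_subset card_mono le_add_diff_inverse2)
  ultimately show ?thesis by (simp add: card_cartesian_product)
qed

lemma clone_arcs_cases [consumes 1, case_names base left right]:
  assumes "e \<in> clone_arcs"
  obtains x w where "e = ((x, 0), (\<alpha> w x, 1))" "x \<in> Y" "w \<in> W"
  | z w where "e = ((z, 2), (\<gamma> w z, 1))" "z \<in> Z" "z \<in> Y" "w \<in> idx z" "w \<in> W"
  | z w where "e = ((\<beta> w z, 0), right_clone z)" "z \<in> Z" "z \<in> Y" "w \<in> idx z" "w \<in> W"
  using assms idx_subset sub(1) unfolding clone_arcs_def by blast

lemma clone_arcs_subset: "clone_arcs \<subseteq> clone_verts \<times> clone_verts"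
proof
  fix e assume "e \<in> clone_arcs"
  then show "e \<in> clone_verts \<times> clone_verts"
  proof (cases rule: clone_arcs_cases)
    case (base x w)
    then show ?thesis using maps(1) by (simp add: clone_verts_def)
  next
    case (left z w)
    then show ?thesis using maps(3) by (simp add: clone_verts_def)
  next
    case (right z w)
    then show ?thesis using maps(2) by (simp add: clone_verts_def right_clone_def)
  qed
qed

lemma clone_arcs_irrefl: "irrefl (clone_arcs \<union> clone_arcs\<inverse>)"
proof -
  have "fst e \<noteq> snd e" if "e \<in> clone_arcs" for e
    using that by (cases rule: clone_arcs_cases) (auto simp: right_clone_def)
  then show ?thesis by (force simp: irrefl_def)
qed

section \<open>Degrees after cloning\<close>

lemma degree_left_vertex:
  assumes x: "x \<in> Y"
  shows "card ((clone_arcs \<union> clone_arcs\<inverse>) `` {(x, 0)}) = card W"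
proof -
  define P where "P w z \<longleftrightarrow> z \<in> Z \<and> w \<in> idx z \<and> \<beta> w z = x" for w z
  \<comment> \<open>Label \<open>w\<close> contributes exactly one neighbour: a clone if the base
    edge was removed, otherwise the old one. \<open>SOME\<close> is determined because
    \<open>\<beta> w\<close> is injective.\<close>
  define f where "f w = (if \<exists>z. P w z then right_clone (SOME z. P w z) else (\<alpha> w x, 1))" for w
  have uniq: "z = z'" if "P w z" "P w z'" for w z z'
    using that bij(2)[of w] idx_subset sub(1) unfolding P_def bij_betw_def
    by (metis inj_onD subsetD)
  then have some: "(SOME z. P w z) = z" if "P w z" for w z
    using that by (metis someI)
  have "(clone_arcs \<union> clone_arcs\<inverse>) `` {(x, 0)} = f ` W"
  proof (intro equalityI subsetI)
    fix v assume "v \<in> (clone_arcs \<union> clone_arcs\<inverse>) `` {(x, 0)}"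
    then have "(\<exists>w\<in>W. \<not> (\<exists>z. P w z) \<and> v = (\<alpha> w x, 1)) \<or> (\<exists>w z. P w z \<and> v = right_clone z)"
      by (auto simp: clone_arcs_def P_def right_clone_def split: if_splits)
    then show "v \<in> f ` W"
    proof (elim disjE bexE exE conjE)
      fix w assume "w \<in> W" "\<nexists>z. P w z" "v = (\<alpha> w x, 1)"
      then show ?thesis by (auto simp: f_def)
    next
      fix w z assume *: "P w z" "v = right_clone z"
      then have "w \<in> W" using idx_subset by (auto simp: P_def)
      moreover have "f w = v" using * some[OF *(1)] by (auto simp: f_def)
      ultimately show ?thesis by blast
    qed
  next
    fix v assume "v \<in> f ` W"
    then obtain w where w: "w \<in> W" "v = f w" by blast
    show "v \<in> (clone_arcs \<union> clone_arcs\<inverse>) `` {(x, 0)}"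
    proof (cases "\<exists>z. P w z")
      case True
      then obtain z where z: "P w z" by blast
      then have "((\<beta> w z, 0), right_clone z) \<in> clone_arcs" unfolding clone_arcs_def P_def by blast
      moreover have "\<beta> w z = x" using z by (simp add: P_def)
      moreover have "f w = right_clone z" using z some[OF z] by (auto simp: f_def)
      ultimately show ?thesis using w(2) by simp
    next
      case False
      then have "((x, 0), (\<alpha> w x, 1)) \<in> clone_arcs" using w x unfolding clone_arcs_def P_def by blast
      then show ?thesis using w False by (auto simp: f_def)
    qed
  qed
  moreover have "inj_on f W"
  proof (rule inj_onI)
    fix w w' assume w: "w \<in> W" "w' \<in> W" "f w = f w'"
    show "w = w'"
    proof (cases "\<exists>z. P w z")
      case True
      then obtain z where z: "P w z" by blast
      then have fw: "f w = right_clone z" using some[OF z] by (auto simp: f_def)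
      then have "\<exists>z'. P w' z'" using w(3) by (auto simp: f_def right_clone_def split: if_splits)
      then obtain z' where z': "P w' z'" by blast
      then have "f w' = right_clone z'" using some[OF z'] by (auto simp: f_def)
      then have "z = z'" using fw w(3) by (simp add: right_clone_def)
      then show ?thesis
        using z z' neq(2)[of z] w(1,2) sub(1) by (auto simp: P_def dest: inj_onD)
    next
      case False
      then have "f w = (\<alpha> w x, 1)" by (simp add: f_def)
      moreover from this w(3) have "f w' = (\<alpha> w' x, 1)"
        by (auto simp: f_def right_clone_def split: if_splits)
      ultimately show ?thesis using w neq(1)[OF x] by (auto dest: inj_onD)
    qed
  qed
  ultimately show ?thesis by (simp add: card_image)
qed

text \<open>Seen from \<open>y\<close>, the base edge with label \<open>w\<close> comes from
  \<open>g w\<close>. Since \<open>\<gamma> w z = \<alpha> w (\<beta> w z)\<close>, a clone reaches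
  \<open>y\<close> along \<open>w\<close> exactly if that edge was removed.\<close>

lemma degree_right_vertex:
  assumes y: "y \<in> Y"
  shows "card ((clone_arcs \<union> clone_arcs\<inverse>) `` {(y, 1)}) = card W"
proof -
  define P where "P w z \<longleftrightarrow> z \<in> Z \<and> w \<in> idx z \<and> \<gamma> w z = y" for w z
  define g where "g w = inv_into Y (\<alpha> w) y" for w
  define f where "f w = (if \<exists>z. P w z then (SOME z. P w z, 2) else (g w, 0 :: nat))" for w
  have g: "g w \<in> Y" "\<alpha> w (g w) = y" if "w \<in> W" for w
    using bij(1)[OF that] y unfolding g_def bij_betw_def by (auto intro: inv_into_into f_inv_into_f)
  have g_uniq: "x = g w" if "w \<in> W" "x \<in> Y" "\<alpha> w x = y" for w x
    using bij(1)[OF that(1)] that g[OF that(1)] by (auto simp: bij_betw_def dest: inj_onD)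
  have P_iff: "P w z \<longleftrightarrow> z \<in> Z \<and> w \<in> idx z \<and> \<beta> w z = g w" if "w \<in> W" for w z
  proof (cases "z \<in> Z")
    case True
    then have "z \<in> Y" using sub by blast
    then have "\<gamma> w z = y \<longleftrightarrow> \<beta> w z = g w"
      using \<gamma>[OF that] g_uniq[OF that, of "\<beta> w z"] maps(2)[OF that] g(2)[OF that] by auto
    then show ?thesis by (simp add: P_def)
  qed (simp add: P_def)
  have uniq: "z = z'" if "P w z" "P w z'" for w z z'
  proof -
    have "w \<in> W" "z \<in> Y" "z' \<in> Y" using that(1,2) idx_subset sub(1) by (auto simp: P_def)
    moreover have "\<beta> w z = g w" "\<beta> w z' = g w" using that P_iff[OF \<open>w \<in> W\<close>] by auto
    ultimately show ?thesis
      using bij(2)[of w] unfolding bij_betw_def by (metis inj_onD)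
  qed
  then have some: "(SOME z. P w z) = z" if "P w z" for w z
    using that by (metis someI)
  have "(clone_arcs \<union> clone_arcs\<inverse>) `` {(y, 1)} = f ` W"
  proof (intro equalityI subsetI)
    fix v assume "v \<in> (clone_arcs \<union> clone_arcs\<inverse>) `` {(y, 1)}"
    then have "(\<exists>w\<in>W. \<exists>x\<in>Y. \<alpha> w x = y \<and> \<not> (\<exists>z\<in>Z. w \<in> idx z \<and> \<beta> w z = x) \<and> v = (x, 0))
        \<or> (\<exists>w z. P w z \<and> v = (z, 2))"
      by (auto simp: clone_arcs_def P_def right_clone_def split: if_splits)
    then show "v \<in> f ` W"
    proof (elim disjE bexE exE conjE)
      fix w x assume *: "w \<in> W" "x \<in> Y" "\<alpha> w x = y" "\<not> (\<exists>z\<in>Z. w \<in> idx z \<and> \<beta> w z = x)" "v = (x, 0)"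
      then have "f w = v" using g_uniq[OF *(1-3)] P_iff[OF *(1)] by (auto simp: f_def)
      then show ?thesis using *(1) by blast
    next
      fix w z assume *: "P w z" "v = (z, 2)"
      then have "w \<in> W" using idx_subset by (auto simp: P_def)
      moreover have "f w = v" using * some[OF *(1)] by (auto simp: f_def)
      ultimately show ?thesis by blast
    qed
  next
    fix v assume "v \<in> f ` W"
    then obtain w where w: "w \<in> W" "v = f w" by blast
    show "v \<in> (clone_arcs \<union> clone_arcs\<inverse>) `` {(y, 1)}"
    proof (cases "\<exists>z. P w z")
      case True
      then obtain z where z: "P w z" by blast
      then have "((z, 2), (\<gamma> w z, 1)) \<in> clone_arcs" unfolding clone_arcs_def P_def by blast
      moreover have "\<gamma> w z = y" using z by (simp add: P_def)
      moreover have "f w = (z, 2)" using z some[OF z] by (auto simp: f_def)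
      ultimately show ?thesis using w(2) by simp
    next
      case False
      then have "((g w, 0), (\<alpha> w (g w), 1)) \<in> clone_arcs"
        using w(1) g[OF w(1)] unfolding clone_arcs_def P_iff[OF w(1)] by blast
      then show ?thesis using w False g(2)[OF w(1)] by (auto simp: f_def)
    qed
  qed
  moreover have "inj_on f W"
  proof (rule inj_onI)
    fix w w' assume w: "w \<in> W" "w' \<in> W" "f w = f w'"
    show "w = w'"
    proof (cases "\<exists>z. P w z")
      case True
      then obtain z where z: "P w z" by blast
      then have fw: "f w = (z, 2)" using some[OF z] by (auto simp: f_def)
      then have "\<exists>z'. P w' z'" using w(3) by (auto simp: f_def split: if_splits)
      then obtain z' where z': "P w' z'" by blast
      then have "f w' = (z', 2)" using some[OF z'] by (auto simp: f_def)
      then have "z = z'" using fw w(3) by simp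
      then show ?thesis
        using z z' neq(3)[of z] w(1,2) sub(1) by (auto simp: P_def dest: inj_onD)
    next
      case False
      then have fw: "f w = (g w, 0)" by (simp add: f_def)
      moreover from this w(3) have "f w' = (g w', 0)"
        by (auto simp: f_def split: if_splits)
      ultimately have "g w = g w'" using w(3) by simp
      then show ?thesis using w(1,2) g neq(1)[OF g(1)[OF w(1)]] by (metis inj_onD)
    qed
  qed
  ultimately show ?thesis by (simp add: card_image)
qed

lemma degree_left_clone:
  assumes z: "z \<in> Z"
  shows "card ((clone_arcs \<union> clone_arcs\<inverse>) `` {(z, 2)}) = card W"
proof -
  have zX: "z \<in> Y" using z sub by blast
  have inj: "inj_on (\<lambda>w. (\<gamma> w z, 1 :: nat)) W" "inj_on (\<lambda>w. (\<beta> w z, 0 :: nat)) W"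
    using neq(2,3)[OF zX] by (auto simp: inj_on_def)
  show ?thesis
  proof (cases "z \<in> M")
    case False
    have "(clone_arcs \<union> clone_arcs\<inverse>) `` {(z, 2)} = (\<lambda>w. (\<gamma> w z, 1)) ` W"
      using z False by (auto simp: clone_arcs_def idx_def right_clone_def image_iff split: if_splits)
    then show ?thesis using inj by (simp add: card_image)
  next
    \<comment> \<open>The merged vertex has \<open>card W1\<close> neighbours on each side, together
      \<open>card W\<close>.\<close>
    case True
    have "(clone_arcs \<union> clone_arcs\<inverse>) `` {(z, 2)} = (\<lambda>w. (\<gamma> w z, 1)) ` W1 \<union> (\<lambda>w. (\<beta> w z, 0)) ` W1"
      using z True by (auto simp: clone_arcs_def idx_def right_clone_def image_iff split: if_splits)
    moreover have "card ((\<lambda>w. (\<gamma> w z, 1 :: nat)) ` W1 \<union> (\<lambda>w. (\<beta> w z, 0)) ` W1)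
        = card ((\<lambda>w. (\<gamma> w z, 1 :: nat)) ` W1) + card ((\<lambda>w. (\<beta> w z, 0 :: nat)) ` W1)"
      using half(1) fin(2) by (intro card_Un_disjoint) (auto intro: finite_subset)
    ultimately show ?thesis
      using inj_on_subset[OF inj(1) half(1)] inj_on_subset[OF inj(2) half(1)] half(2)
      by (simp add: card_image)
  qed
qed

lemma degree_right_clone:
  assumes z: "z \<in> Z - M"
  shows "card ((clone_arcs \<union> clone_arcs\<inverse>) `` {(z, 3)}) = card W"
proof -
  have zX: "z \<in> Y" using z sub by blast
  have "inj_on (\<lambda>w. (\<beta> w z, 0 :: nat)) W"
    using neq(2)[OF zX] by (auto simp: inj_on_def)
  moreover have "(clone_arcs \<union> clone_arcs\<inverse>) `` {(z, 3)} = (\<lambda>w. (\<beta> w z, 0)) ` W"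
    using z by (auto simp: clone_arcs_def idx_def right_clone_def image_iff split: if_splits)
  ultimately show ?thesis by (simp add: card_image)
qed

lemma regular: "v \<in> clone_verts \<Longrightarrow> card ((clone_arcs \<union> clone_arcs\<inverse>) `` {v}) = card W"
  unfolding clone_verts_def
  using degree_left_vertex[of "fst v"] degree_right_vertex[of "fst v"] degree_left_clone[of "fst v"] degree_right_clone[of "fst v"]
  by (cases v) auto

text \<open>Only a merged vertex lies in both \<open>L\<close> and \<open>R\<close>. There is at
  most one, and without loops it cannot be in both \<open>A\<close> and \<open>B\<close>, so one of
  the two sets avoids it. The other set has at least two vertices, hence one that is not merged, and
  that vertex fixes the direction of all arcs.\<close>

lemma one_direction:
  fixes A B :: "('x \<times> nat) set"
  assumes M: "card M \<le> 1" and AB: "A \<times> B \<subseteq> clone_arcs \<union> clone_arcs\<inverse>" "card A \<ge> 2" "card B \<ge> 2"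
  shows "A \<times> B \<subseteq> clone_arcs \<or> B \<times> A \<subseteq> clone_arcs"
proof -
  define L where "L = clone_verts \<inter> UNIV \<times> {0, 2}"
  define R where "R = clone_verts \<inter> UNIV \<times> {1, 3} \<union> M \<times> {2}"
  have finM: "finite M" using finite_subset[OF sub(2)] finite_subset[OF sub(1) fin(1)] by simp
  have LR: "L \<inter> R = M \<times> {2}"
    using sub by (auto simp: L_def R_def clone_verts_def)
  have arcLR: "clone_arcs \<subseteq> L \<times> R"
  proof
    fix e assume e: "e \<in> clone_arcs"
    then have "e \<in> clone_verts \<times> clone_verts" using clone_arcs_subset by blast
    moreover have "snd (fst e) \<in> {0, 2} \<and> (snd (snd e) \<in> {1, 3} \<or> snd e \<in> M \<times> {2})"
      using e by (cases rule: clone_arcs_cases) (auto simp: right_clone_def)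
    ultimately show "e \<in> L \<times> R"
      unfolding L_def R_def by (auto simp: mem_Times_iff)
  qed
  have dir: "A' \<times> B' \<subseteq> clone_arcs" if AB': "A' \<times> B' \<subseteq> clone_arcs \<union> clone_arcs\<inverse>" and a: "a \<in> A'" "a \<in> L" "a \<notin> R"
      and nB: "B' \<inter> M \<times> {2} = {}" for A' B' a
  proof -
    have "B' \<subseteq> R" using AB' a arcLR by fastforce
    moreover have "B' \<inter> L = {}" using nB LR \<open>B' \<subseteq> R\<close> by blast
    ultimately show ?thesis using AB' arcLR by blast
  qed
  have pure: "\<exists>a\<in>A'. a \<notin> M \<times> {2}" if "card A' \<ge> 2" for A' :: "('x \<times> nat) set"
  proof (rule ccontr)
    assume "\<not> ?thesis"
    then have "A' \<subseteq> M \<times> {2}" by blast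
    then have "card A' \<le> card (M \<times> {2::nat})" using finM by (intro card_mono) auto
    then show False using that M by (simp add: card_cartesian_product)
  qed
  have cl: "A \<subseteq> L \<union> R" "B \<subseteq> L \<union> R"
  proof -
    have "A \<noteq> {}" "B \<noteq> {}" using AB(2,3) by auto
    then obtain a b where ab: "a \<in> A" "b \<in> B" by blast
    show "A \<subseteq> L \<union> R" using AB(1) ab(2) arcLR by blast
    show "B \<subseteq> L \<union> R" using AB(1) ab(1) arcLR by blast
  qed
  have BA: "B \<times> A \<subseteq> clone_arcs \<union> clone_arcs\<inverse>" using AB(1) by blast
  have rev: "B' \<times> A' \<subseteq> clone_arcs" if AB': "A' \<times> B' \<subseteq> clone_arcs \<union> clone_arcs\<inverse>" and a: "a \<in> A'" "a \<in> R" "a \<notin> L"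
      and nB: "B' \<inter> M \<times> {2} = {}" for A' B' a
  proof -
    have "B' \<subseteq> L" using AB' a arcLR by fastforce
    moreover have "B' \<inter> R = {}" using nB LR \<open>B' \<subseteq> L\<close> by blast
    ultimately show ?thesis using AB' arcLR by blast
  qed
  show ?thesis
  proof (cases "B \<inter> M \<times> {2} = {}")
    case True
    obtain a where "a \<in> A" "a \<notin> M \<times> {2}" using pure[OF AB(2)] by blast
    then show ?thesis using dir[OF AB(1) _ _ _ True] rev[OF AB(1) _ _ _ True] cl LR by blast
  next
    case False
    then obtain b where b: "b \<in> B" "b \<in> M \<times> {2}" by blast
    have uniq: "z = z'" if "z \<in> M" "z' \<in> M" for z z'
      using that M card_le_Suc0_iff_eq[OF finM] by simp
    have "a = b" if "a \<in> M \<times> {2}" for a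
      using that b(2) uniq by auto
    then have "(a, a) \<in> clone_arcs \<union> clone_arcs\<inverse>" if "a \<in> A" "a \<in> M \<times> {2}" for a
      using that AB(1) b(1) by blast
    then have "A \<inter> M \<times> {2} = {}" using clone_arcs_irrefl by (auto simp: irrefl_def)
    moreover obtain b where "b \<in> B" "b \<notin> M \<times> {2}" using pure[OF AB(3)] by blast
    ultimately show ?thesis using dir[OF BA] rev[OF BA] cl LR by blast
  qed
qed

text \<open>\<open>\<iota> z\<close> is the right vertex whose clone is attached to \<open>z\<close>. Replacing clones by originals is injective on
  both sides of a complete bipartite subgraph, because a clone and its original have no common neighbour.\<close>

lemma clones_related:
  fixes \<iota> :: "'x \<Rightarrow> 'x" and \<rho> :: "'x \<Rightarrow> 'x \<Rightarrow> bool"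
  assumes \<iota>: "inj_on \<iota> Y" "\<And>x. x \<in> Y \<Longrightarrow> \<iota> x \<in> Y"
    and \<rho>: "\<And>w x. w \<in> W \<Longrightarrow> x \<in> Y \<Longrightarrow> \<rho> x (\<alpha> w x)" "\<And>w x. w \<in> W \<Longrightarrow> x \<in> Y \<Longrightarrow> \<rho> x (\<gamma> w x)"
      "\<And>w x. w \<in> W \<Longrightarrow> x \<in> Y \<Longrightarrow> \<rho> (\<beta> w x) (\<iota> x)"
    and clash: "\<And>w w' x. w \<in> W \<Longrightarrow> w' \<in> W \<Longrightarrow> x \<in> Y \<Longrightarrow> \<alpha> w x \<noteq> \<gamma> w' x"
      "\<And>w w' x. w \<in> W \<Longrightarrow> w' \<in> W \<Longrightarrow> x \<in> Y \<Longrightarrow> \<alpha> w (\<beta> w' x) \<noteq> \<iota> x"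
    and AB: "A \<times> B \<subseteq> clone_arcs" "A \<noteq> {}" "B \<noteq> {}"
  obtains U V where "U \<subseteq> Y" "V \<subseteq> Y" "card U = card A" "card V = card B" "\<And>x y. x \<in> U \<Longrightarrow> y \<in> V \<Longrightarrow> \<rho> x y"
proof
  define \<phi> where "\<phi> v = (if snd v = (1::nat) then fst v else \<iota> (fst v))" for v :: "'x \<times> nat"
  have idx: "w \<in> W" if "w \<in> idx z" for w z using that idx_subset by blast
  have ZX: "z \<in> Y" if "z \<in> Z" for z using that sub by blast
  have rc: "snd (right_clone z) \<noteq> 1" "\<phi> (right_clone z) = \<iota> z" for z
    by (simp_all add: \<phi>_def right_clone_def)
  have arc: "fst a \<in> Y \<and> snd a \<in> {0, 2} \<and> \<phi> b \<in> Y \<and> \<rho> (fst a) (\<phi> b)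
      \<and> (snd b = 1 \<or> (\<exists>z\<in>Z. b = right_clone z))" if "(a, b) \<in> clone_arcs" for a b
    using that
  proof (cases rule: clone_arcs_cases)
    case (base x w)
    then show ?thesis using maps(1) \<rho>(1) by (simp add: \<phi>_def)
  next
    case (left z w)
    then show ?thesis using maps(3) \<rho>(2) by (simp add: \<phi>_def)
  next
    case (right z w)
    then show ?thesis using maps(2) \<rho>(3) \<iota>(2) rc by auto
  qed
  have A: "fst a \<in> Y \<and> snd a \<in> {0, 2}" if "a \<in> A" for a
  proof -
    obtain b where "b \<in> B" using AB by blast
    then show ?thesis using arc[of a b] AB(1) that by blast
  qed
  have B: "\<phi> b \<in> Y \<and> (snd b = 1 \<or> (\<exists>z\<in>Z. b = right_clone z))" if "b \<in> B" for b
  proof -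
    obtain a where "a \<in> A" using AB by blast
    then show ?thesis using arc[of a b] AB(1) that by blast
  qed
  show "fst ` A \<subseteq> Y" "\<phi> ` B \<subseteq> Y" using A B by auto
  show "\<rho> x y" if "x \<in> fst ` A" "y \<in> \<phi> ` B" for x y
    using that AB arc by blast
  have "inj_on fst A"
  proof (rule inj_onI, rule ccontr)
    fix a a' assume a: "a \<in> A" "a' \<in> A" "fst a = fst a'" "a \<noteq> a'"
    then obtain x where x: "(x, 0) \<in> A" "(x, 2) \<in> A"
      using A[OF a(1)] A[OF a(2)] by (cases a; cases a') auto
    obtain b where b: "b \<in> B" using AB by blast
    have "((x, 2), b) \<in> clone_arcs" using x AB(1) b by blast
    then obtain w where w: "w \<in> W" "b = (\<gamma> w x, 1)" "x \<in> Y"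
      by (cases rule: clone_arcs_cases) auto
    have "((x, 0), b) \<in> clone_arcs" using x AB(1) b by blast
    moreover have "snd b = 1" using w(2) by simp
    ultimately obtain w' where "w' \<in> W" "b = (\<alpha> w' x, 1)"
      by (cases rule: clone_arcs_cases) (use rc(1) in auto)
    then show False using clash(1)[of w' w x] w by auto
  qed
  then show "card (fst ` A) = card A" by (rule card_image)
  have "inj_on \<phi> B"
  proof (rule inj_onI)
    fix b b' assume b: "b \<in> B" "b' \<in> B" "\<phi> b = \<phi> b'"
    have mixed: False if bb: "b \<in> B" "b' \<in> B" "\<phi> b = \<phi> b'" "snd b = 1" "z \<in> Z" "b' = right_clone z" for b b' z
    proof -
      obtain a where a: "a \<in> A" using AB by blast
      have "(a, b') \<in> clone_arcs" using AB(1) a bb by blast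
      then obtain w where w: "w \<in> W" "a = (\<beta> w z, 0)"
        by (cases rule: clone_arcs_cases) (use bb(6) in \<open>auto simp: right_clone_def split: if_splits\<close>)
      have "(a, b) \<in> clone_arcs" using AB(1) a bb by blast
      then obtain w' where "w' \<in> W" "b = (\<alpha> w' (\<beta> w z), 1)"
        by (cases rule: clone_arcs_cases) (use w(2) bb(4) rc(1) in auto)
      moreover have "\<phi> b' = \<iota> z" using bb(6) rc(2) by simp
      ultimately show False using clash(2)[of w' w z] w bb(3,5) ZX by (auto simp: \<phi>_def)
    qed
    from B[OF b(1), THEN conjunct2] B[OF b(2), THEN conjunct2] show "b = b'"
    proof (elim disjE bexE)
      assume "snd b = 1" "snd b' = 1"
      then show ?thesis using b(3) by (simp add: \<phi>_def prod_eq_iff)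
    next
      fix z z' assume z: "z \<in> Z" "b = right_clone z" "z' \<in> Z" "b' = right_clone z'"
      then have "\<iota> z = \<iota> z'" using b(3) rc(2) by simp
      then have "z = z'" using z(1,3) \<iota>(1) ZX by (meson inj_onD)
      then show ?thesis using z by simp
    qed (use mixed[OF b] mixed[OF b(2,1) b(3)[symmetric]] in blast)+
  qed
  then show "card (\<phi> ` B) = card B" by (rule card_image)
qed

text \<open>A copy in the enlarged graph runs in one direction and projects to completely
  \<open>\<rho>\<close>-related sets of the same sizes. Symmetry of \<open>\<rho>\<close> covers the
  case in which the \<open>t\<close> vertices are on the left.\<close>

theorem rex_clone_surgery_ge:
  fixes \<iota> :: "'x \<Rightarrow> 'x" and \<rho> :: "'x \<Rightarrow> 'x \<Rightarrow> bool"
  assumes M: "card M \<le> 1"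
    and \<iota>: "inj_on \<iota> Y" "\<And>x. x \<in> Y \<Longrightarrow> \<iota> x \<in> Y"
    and \<rho>: "\<And>w x. w \<in> W \<Longrightarrow> x \<in> Y \<Longrightarrow> \<rho> x (\<alpha> w x)" "\<And>w x. w \<in> W \<Longrightarrow> x \<in> Y \<Longrightarrow> \<rho> x (\<gamma> w x)"
      "\<And>w x. w \<in> W \<Longrightarrow> x \<in> Y \<Longrightarrow> \<rho> (\<beta> w x) (\<iota> x)"
    and clash: "\<And>w w' x. w \<in> W \<Longrightarrow> w' \<in> W \<Longrightarrow> x \<in> Y \<Longrightarrow> \<alpha> w x \<noteq> \<gamma> w' x"
      "\<And>w w' x. w \<in> W \<Longrightarrow> w' \<in> W \<Longrightarrow> x \<in> Y \<Longrightarrow> \<alpha> w (\<beta> w' x) \<noteq> \<iota> x"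
    and st: "2 \<le> s" "2 \<le> t"
    and sym: "\<And>x y. \<rho> x y \<Longrightarrow> \<rho> y x"
    and free: "\<And>U V. U \<subseteq> Y \<Longrightarrow> V \<subseteq> Y \<Longrightarrow> card U = s \<Longrightarrow> card V = t \<Longrightarrow> \<exists>x\<in>U. \<exists>y\<in>V. \<not> \<rho> x y"
  shows "(2 * card Y + 2 * card Z - card M) * card W
    \<le> 2 * rex (2 * card Y + 2 * card Z - card M) (complete_bipartite s t)"
proof -
  have n: "card clone_verts = 2 * card Y + 2 * card Z - card M"
    using card_clone_verts by simp
  have "card clone_verts * card W \<le> 2 * rex (card clone_verts) (complete_bipartite s t)"
  proof (rule rex_ge[OF finite_clone_verts, of "clone_arcs \<union> clone_arcs\<inverse>"])
    show "clone_arcs \<union> clone_arcs\<inverse> \<subseteq> clone_verts \<times> clone_verts" using clone_arcs_subset by blast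
    show "sym (clone_arcs \<union> clone_arcs\<inverse>)" by (rule sym_Un_converse)
    show "irrefl (clone_arcs \<union> clone_arcs\<inverse>)" by (rule clone_arcs_irrefl)
    show "card ((clone_arcs \<union> clone_arcs\<inverse>) `` {v}) = card W" if "v \<in> clone_verts" for v
      using that by (rule regular)
    fix A B :: "('x \<times> nat) set" assume card: "card A = s" "card B = t"
    show "\<not> A \<times> B \<subseteq> clone_arcs \<union> clone_arcs\<inverse>"
    proof
      assume "A \<times> B \<subseteq> clone_arcs \<union> clone_arcs\<inverse>"
      then consider "A \<times> B \<subseteq> clone_arcs" | "B \<times> A \<subseteq> clone_arcs"
        using one_direction[OF M] card st by blast
      moreover have ne: "A \<noteq> {}" "B \<noteq> {}" using card st by auto
      ultimately show False
      proof cases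
        case 1
        show False
        proof (rule clones_related[of \<iota> \<rho> A B])
          show False if "U \<subseteq> Y" "V \<subseteq> Y" "card U = card A" "card V = card B"
            "\<And>x y. x \<in> U \<Longrightarrow> y \<in> V \<Longrightarrow> \<rho> x y" for U V
            using free[of U V] that card by auto
        qed (use 1 ne \<iota> \<rho> clash in simp_all)
      next
        case 2
        show False
        proof (rule clones_related[of \<iota> \<rho> B A])
          show False if "U \<subseteq> Y" "V \<subseteq> Y" "card U = card B" "card V = card A"
            "\<And>x y. x \<in> U \<Longrightarrow> y \<in> V \<Longrightarrow> \<rho> x y" for U V
            using free[of V U] that card sym by blast
        qed (use 2 ne \<iota> \<rho> clash in simp_all)
      qed
    qed
  qed
  then show ?thesis by (simp only: n)
qed

end

subsection \<open>Projective norm graphs\<close>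

lemma card_roots_coprime_pderiv:
  fixes P :: "'a::alg_closed_field poly"
  assumes "P \<noteq> 0" "\<And>x. poly P x = 0 \<Longrightarrow> poly (pderiv P) x \<noteq> 0"
  shows "card {x. poly P x = 0} = Polynomial.degree P"
proof -
  obtain A where A: "size A = Polynomial.degree P"
    and P: "P = Polynomial.smult (Polynomial.lead_coeff P) (\<Prod>x\<in>#A. [:-x, 1:])"
    using alg_closed_imp_factorization[OF assms(1)] by blast
  have lc: "Polynomial.lead_coeff P \<noteq> 0" using assms(1) by simp
  have roots: "poly P x = 0 \<longleftrightarrow> x \<in># A" for x
  proof -
    have "poly (\<Prod>y\<in>#A. [:-y, 1:]) x = (\<Prod>y\<in>#A. x - y)"
      by (induction A) (auto simp: left_diff_distrib)
    moreover have "(\<Prod>y\<in>#A. x - y) = 0 \<longleftrightarrow> x \<in># A"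
      by (induction A) auto
    ultimately show ?thesis
      using lc by (subst P) (simp only: poly_smult mult_eq_0_iff, simp)
  qed
  \<comment> \<open>A repeated linear factor would give a common root of \<open>P\<close> and its
    derivative, so the multiset \<open>A\<close> is a set.\<close>
  have "count A x \<le> 1" for x
  proof (rule ccontr)
    assume "\<not> ?thesis"
    then have cnt: "2 \<le> count A x" by simp
    define B where "B = A - {#x, x#}"
    have "A = add_mset x (add_mset x B)"
      by (rule multiset_eqI) (use cnt in \<open>auto simp: B_def\<close>)
    then have "(\<Prod>y\<in>#A. [:-y, 1:]) = [:-x, 1:] * ([:-x, 1:] * (\<Prod>y\<in>#B. [:-y, 1:]))" by simp
    then obtain Q where eq: "P = [:-x, 1:] * ([:-x, 1:] * Q)"
      using P by (metis mult_smult_right)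
    have "poly P x = 0" by (simp add: eq)
    moreover have "poly (pderiv P) x = 0"
      by (simp only: eq pderiv_mult poly_add poly_mult) simp
    ultimately show False using assms(2) by blast
  qed
  then have cnt: "count A x \<le> 1" for x .
  have "A = mset_set (set_mset A)"
  proof (rule multiset_eqI)
    fix x
    show "count A x = count (mset_set (set_mset A)) x"
    proof (cases "x \<in># A")
      case True
      then have "0 < count A x" by simp
      then have "count A x = 1" using cnt[of x] by linarith
      then show ?thesis using True by simp
    next
      case False
      then show ?thesis by (simp add: not_in_iff)
    qed
  qed
  then have "card (set_mset A) = size A" by (metis size_mset_set)
  moreover have "{x. poly P x = 0} = set_mset A" using roots by blast
  ultimately show ?thesis using A by simp
qed

text \<open>The derivative of \<open>x ^ (CHAR('a) ^ m) - x\<close> is -1, so all roots are simple.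
  They form the subfield of that order.\<close>

lemma card_power_fixpoints:
  assumes p: "normalization_semidom_class.prime CHAR('a::alg_closed_field)" and m: "m > 0"
  shows "card {x :: 'a. x ^ (CHAR('a) ^ m) = x} = CHAR('a) ^ m"
proof -
  let ?n = "CHAR('a) ^ m"
  define P :: "'a poly" where "P = Polynomial.monom 1 ?n - [:0, 1:]"
  have n: "1 < ?n" using p m prime_gt_1_nat one_less_power by blast
  have deg: "Polynomial.degree P = ?n"
  proof -
    have "Polynomial.degree (Polynomial.monom (1::'a) ?n + - [:0, 1:]) = Polynomial.degree (Polynomial.monom (1::'a) ?n)"
      using n by (intro degree_add_eq_left) (simp add: degree_monom_eq)
    then show ?thesis unfolding P_def diff_conv_add_uminus by (simp only: degree_monom_eq one_neq_zero not_False_eq_True)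
  qed
  have "of_nat ?n = (0 :: 'a)"
    using m by (simp add: of_nat_eq_0_iff_char_dvd)
  then have "pderiv P = - 1"
    using m by (simp add: P_def zero_power pderiv_diff pderiv_monom pderiv_pCons one_pCons)
  moreover have "P \<noteq> 0"
  proof
    assume "P = 0"
    then have "Polynomial.degree P = 0" by simp
    then show False using deg n by linarith
  qed
  ultimately have "card {x. poly P x = 0} = Polynomial.degree P"
    by (intro card_roots_coprime_pderiv) auto
  then show ?thesis using deg by (simp add: P_def poly_monom)
qed

text \<open>If there were only \<open>m\<close> elements, the fixed points of the
  \<open>m\<close>-th iterate of Frobenius alone would number
  \<open>CHAR('a) ^ m > m\<close>.\<close>

lemma infinite_UNIV_alg_closed:
  assumes p: "normalization_semidom_class.prime CHAR('a::alg_closed_field)"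
  shows "infinite (UNIV :: 'a set)"
proof
  assume fin: "finite (UNIV :: 'a set)"
  define m where "m = card (UNIV :: 'a set)"
  have "m > 0" using fin by (simp add: m_def card_gt_0_iff)
  then have "CHAR('a) ^ m \<le> m"
    using card_power_fixpoints[OF p] card_mono[OF fin subset_UNIV] unfolding m_def by metis
  moreover have "m < CHAR('a) ^ m"
    using p prime_gt_1_nat by (intro power_gt_expt) auto
  ultimately show False by simp
qed

text \<open>Each chosen element discards itself and at most \<open>c\<close> bad partners, hence the
  factor \<open>c + 1\<close>.\<close>

lemma greedy_independent_set:
  assumes "finite S" and sym: "\<And>x y. bad x y \<Longrightarrow> bad y x"
    and "\<And>x. x \<in> S \<Longrightarrow> card {y\<in>S. bad x y} \<le> c"
  shows "\<exists>T\<subseteq>S. (\<forall>x\<in>T. \<forall>y\<in>T. x \<noteq> y \<longrightarrow> \<not> bad x y) \<and> card S \<le> (c + 1) * card T"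
  using assms(1,3)
proof (induction S rule: finite_psubset_induct)
  case (psubset S)
  show ?case
  proof (cases "S = {}")
    case False
    then obtain x where x: "x \<in> S" by blast
    define S' where "S' = S - {x} - {y\<in>S. bad x y}"
    have S': "S' \<subset> S" using x by (auto simp: S'_def)
    have fin: "finite {y\<in>S. bad x y}" "finite S'"
      using psubset.hyps(1) by (simp_all add: S'_def)
    have "card {y\<in>S'. bad z y} \<le> c" if "z \<in> S'" for z
    proof -
      have "card {y\<in>S'. bad z y} \<le> card {y\<in>S. bad z y}"
        using S' psubset.hyps(1) by (intro card_mono) auto
      also have "\<dots> \<le> c" using that S' by (intro psubset.prems) auto
      finally show ?thesis .
    qed
    from psubset.IH[OF S' this] obtain T where T: "T \<subseteq> S'" "\<forall>x\<in>T. \<forall>y\<in>T. x \<noteq> y \<longrightarrow> \<not> bad x y"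
      "card S' \<le> (c + 1) * card T" by blast
    have "x \<notin> T" using T(1) by (auto simp: S'_def)
    moreover have "finite T" using T(1) fin(2) by (rule finite_subset)
    ultimately have card_T: "card (insert x T) = Suc (card T)" by simp
    have "S \<subseteq> insert x ({y\<in>S. bad x y} \<union> S')" by (auto simp: S'_def)
    then have "card S \<le> card (insert x ({y\<in>S. bad x y} \<union> S'))"
      using fin by (intro card_mono) auto
    also have "\<dots> \<le> Suc (card ({y\<in>S. bad x y} \<union> S'))" by (rule card_insert_le_m1) simp_all
    also have "\<dots> \<le> Suc (card {y\<in>S. bad x y} + card S')" using card_Un_le by simp
    also have "\<dots> \<le> (c + 1) * card (insert x T)"
      using psubset.prems[OF x] T(3) card_T by simp
    finally have "card S \<le> (c + 1) * card (insert x T)" .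
    moreover have "\<forall>y\<in>insert x T. \<forall>z\<in>insert x T. y \<noteq> z \<longrightarrow> \<not> bad y z"
      using T(1,2) sym by (fastforce simp: S'_def)
    moreover have "insert x T \<subseteq> S" using T(1) x by (auto simp: S'_def)
    ultimately show ?thesis by blast
  qed simp
qed

text \<open>The finite fields live as subsets of one algebraically closed field, so \<open>q\<close>
  can vary without a separate type for each field, and the bound on solutions is applied over an
  infinite field.\<close>

locale norm_graph =
  fixes q d :: nat and ty :: "'a::alg_closed_field itself"
  assumes p: "normalization_semidom_class.prime CHAR('a)" and q: "\<exists>j>0. q = CHAR('a) ^ j" and d: "d > 0"
begin

text \<open>\<open>E\<close> and \<open>F\<close> are the subfields of order \<open>q ^ d\<close> and \<open>q\<close>.\<close>

definition E :: "'a set" where "E = {x. x ^ (q ^ d) = x}"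
definition F :: "'a set" where "F = {x. x ^ q = x}"
text \<open>The norm of \<open>E\<close> over \<open>F\<close>: the product of the \<open>d\<close>
  conjugates of \<open>x\<close> under Frobenius.\<close>

definition N :: "'a \<Rightarrow> 'a" where "N x = (\<Prod>i<d. x ^ (q ^ i))"

lemma q_gt_1: "q > 1"
proof -
  obtain j where "j > 0" "q = CHAR('a) ^ j" using q by blast
  then show ?thesis using p prime_gt_1_nat one_less_power by blast
qed

lemma frob_add: "((x :: 'a) + y) ^ (q ^ i) = x ^ (q ^ i) + y ^ (q ^ i)"
proof -
  obtain j where "q = CHAR('a) ^ j" using q by blast
  then show ?thesis by (intro freshmans_dream'[OF p, of _ "j * i"]) (simp add: power_mult)
qed

lemma frob_diff: "((x :: 'a) - y) ^ (q ^ i) = x ^ (q ^ i) - y ^ (q ^ i)"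
  using frob_add[of "x - y" y i] by simp

lemma frob_inj: "(x :: 'a) ^ (q ^ i) = y ^ (q ^ i) \<longleftrightarrow> x = y"
proof
  assume "x ^ (q ^ i) = y ^ (q ^ i)"
  then have "(x - y) ^ (q ^ i) = 0" by (simp add: frob_diff)
  then show "x = y" by simp
qed simp

lemma card_E: "card E = q ^ d"
proof -
  obtain j where "j > 0" "q = CHAR('a) ^ j" using q by blast
  then show ?thesis
    using card_power_fixpoints[OF p, of "j * d"] d unfolding E_def by (simp add: power_mult)
qed

lemma card_F: "card F = q"
proof -
  obtain j where "j > 0" "q = CHAR('a) ^ j" using q by blast
  then show ?thesis using card_power_fixpoints[OF p, of j] unfolding F_def by simp
qed

lemma finite_E: "finite E"
  using card_E q_gt_1 by (intro card_ge_0_finite) simp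

lemma finite_F: "finite F"
  using card_F q_gt_1 by (intro card_ge_0_finite) simp

lemma E_closed [simp]:
  "0 \<in> E" "1 \<in> E" "x \<in> E \<Longrightarrow> y \<in> E \<Longrightarrow> x + y \<in> E" "x \<in> E \<Longrightarrow> y \<in> E \<Longrightarrow> x - y \<in> E"
  "x \<in> E \<Longrightarrow> y \<in> E \<Longrightarrow> x * y \<in> E" "x \<in> E \<Longrightarrow> y \<in> E \<Longrightarrow> x / y \<in> E"
  using q_gt_1 by (simp_all add: E_def frob_add frob_diff power_mult_distrib power_divide)

lemma E_minus [simp]: "x \<in> E \<Longrightarrow> - x \<in> E"
  using E_closed(4)[OF E_closed(1), of x] by simp

lemma F_closed [simp]: "0 \<in> F" "1 \<in> F" "x \<in> F \<Longrightarrow> y \<in> F \<Longrightarrow> x * y \<in> F" "x \<in> F \<Longrightarrow> y \<in> F \<Longrightarrow> x / y \<in> F"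
  using q_gt_1 by (simp_all add: F_def power_mult_distrib power_divide)

lemma N_mult: "N (x * y) = N x * N y"
  by (simp add: N_def power_mult_distrib prod.distrib)

lemma N_divide: "N (x / y) = N x / N y"
  by (simp add: N_def power_divide prod_dividef)

lemma N_eq_0_iff [simp]: "N x = 0 \<longleftrightarrow> x = 0"
  using d q_gt_1 by (auto simp: N_def)

text \<open>Raising to the power \<open>q\<close> permutes the conjugates cyclically, because
  \<open>x ^ (q ^ d) = x\<close>.\<close>

lemma N_in_F: "x \<in> E \<Longrightarrow> N x \<in> F"
proof -
  assume x: "x \<in> E"
  obtain e where e: "d = Suc e" using d by (cases d) auto
  have "N x ^ q = (\<Prod>i<d. x ^ (q ^ Suc i))"
    by (simp add: N_def prod_power_distrib mult.commute flip: power_mult)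
  also have "\<dots> = (\<Prod>i<e. x ^ (q ^ Suc i)) * x ^ (q ^ d)"
    by (simp add: e)
  also have "x ^ (q ^ d) = x ^ (q ^ 0)" using x by (simp add: E_def)
  also have "(\<Prod>i<e. x ^ (q ^ Suc i)) * x ^ (q ^ 0) = (\<Prod>i<Suc e. x ^ (q ^ i))"
    by (simp only: prod.lessThan_Suc_shift mult.commute)
  also have "\<dots> = N x" unfolding N_def using e by simp
  finally show ?thesis by (simp add: F_def)
qed

text \<open>Frobenius is additive, so \<open>N (y - c i)\<close> is the product of the differences
  \<open>y ^ (q ^ k) - c i ^ (q ^ k)\<close>. Treating the conjugates of \<open>y\<close> as
  \<open>d\<close> separate unknowns gives a system of products of linear factors.\<close>

lemma card_norm_equations_le:
  assumes I: "finite I" "card I = d" "inj_on c I" and V: "finite V" "\<And>y i. y \<in> V \<Longrightarrow> i \<in> I \<Longrightarrow> N (y - c i) = b i"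
  shows "card V \<le> fact d"
proof -
  define v where "v y k = y ^ (q ^ k)" for y :: 'a and k :: nat
  have "inj_on v V" by (rule inj_onI) (metis v_def frob_inj)
  then have "card V = card (v ` V)" by (simp add: card_image)
  also have "\<dots> \<le> fact d"
  proof (rule card_solutions_le_fact[where a = "\<lambda>i k. c i ^ (q ^ k)" and b = b])
    show "infinite (UNIV :: 'a set)" by (rule infinite_UNIV_alg_closed[OF p])
    show "inj_on (\<lambda>i. c i ^ (q ^ k)) I" for k
      using I(3) by (auto simp: inj_on_def frob_inj)
    show "(\<Prod>k<d. w k - c i ^ (q ^ k)) = b i" if "w \<in> v ` V" "i \<in> I" for w i
      using that V(2) by (auto simp: v_def N_def frob_diff)
    show "w = w'" if "w \<in> v ` V" "w' \<in> v ` V" "\<And>k. k < d \<Longrightarrow> w k = w' k" for w w'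
      using that(1,2) that(3)[OF d] by (auto simp: v_def)
  qed (use d I V in auto)
  finally show ?thesis .
qed

section \<open>Common neighbours in the projective norm graph\<close>

definition Y :: "('a \<times> 'a) set" where "Y = E \<times> (F - {0})"

definition \<rho> :: "'a \<times> 'a \<Rightarrow> 'a \<times> 'a \<Rightarrow> bool" where
  "\<rho> x y \<longleftrightarrow> N (fst x + fst y) = snd x * snd y"

lemma finite_Y: "finite Y"
  using finite_E finite_F by (simp add: Y_def)

lemma card_Y: "card Y = q ^ d * (q - 1)"
  using card_E card_F finite_F by (simp add: Y_def card_cartesian_product card_Diff_singleton)

text \<open>Dividing the equations of the other \<open>d\<close> vertices by that of
  \<open>u0\<close> cancels \<open>snd y\<close>. In the unknown
  \<open>g y = 1 / (fst u0 + fst y)\<close> the quotients become equations that prescribe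
  \<open>N (g y - c x)\<close>, and \<open>card_norm_equations_le\<close> applies.\<close>

theorem card_common_neighbours_le:
  assumes U: "U \<subseteq> Y" "card U = Suc d" and V: "V \<subseteq> Y" and UV: "\<And>x y. x \<in> U \<Longrightarrow> y \<in> V \<Longrightarrow> \<rho> x y"
  shows "card V \<le> fact d"
proof (cases "V = {}")
  case False
  then obtain y0 where y0: "y0 \<in> V" by blast
  have finU: "finite U" using U(2) by (intro card_ge_0_finite) simp
  have "U \<noteq> {}" using U(2) by auto
  then obtain u0 where u0: "u0 \<in> U" by blast
  have nz: "snd x \<noteq> 0" "fst x \<in> E" if "x \<in> Y" for x
    using that by (auto simp: Y_def)
  have sum_nz: "fst x + fst y \<noteq> 0" if "x \<in> U" "y \<in> V" for x y
  proof
    assume "fst x + fst y = 0"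
    then have "N (fst x + fst y) = 0" by simp
    then have "snd x * snd y = 0" using UV[OF that] by (metis \<rho>_def)
    then show False using nz(1)[OF subsetD[OF U(1) that(1)]] nz(1)[OF subsetD[OF V that(2)]] by simp
  qed
  have inj: "inj_on fst U"
  proof (rule inj_onI)
    fix x x' assume x: "x \<in> U" "x' \<in> U" "fst x = fst x'"
    have "snd x * snd y0 = snd x' * snd y0"
      using UV[OF x(1) y0] UV[OF x(2) y0] x(3) by (simp add: \<rho>_def)
    then show "x = x'" using nz(1)[OF subsetD[OF V y0]] x(3) by (simp add: prod_eq_iff)
  qed
  define g where "g y = 1 / (fst u0 + fst y)" for y :: "'a \<times> 'a"
  define c where "c x = - 1 / (fst x - fst u0)" for x :: "'a \<times> 'a"
  have "inj_on g V"
  proof (rule inj_onI)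
    fix y y' assume y: "y \<in> V" "y' \<in> V" "g y = g y'"
    have "fst u0 + fst y = fst u0 + fst y'"
      using y(3) sum_nz[OF u0 y(1)] sum_nz[OF u0 y(2)] by (simp add: g_def field_simps)
    then have 1: "fst y = fst y'" by simp
    then have "snd u0 * snd y = snd u0 * snd y'"
      using UV[OF u0 y(1)] UV[OF u0 y(2)] by (simp add: \<rho>_def)
    then show "y = y'" using 1 nz(1)[OF subsetD[OF U(1) u0]] by (simp add: prod_eq_iff)
  qed
  then have "card V = card (g ` V)" by (simp add: card_image)
  also have "\<dots> \<le> fact d"
  proof (rule card_norm_equations_le[where I = "U - {u0}" and c = c
        and b = "\<lambda>x. snd x / (snd u0 * N (fst x - fst u0))"])
    have diff: "fst x - fst u0 \<noteq> 0" if "x \<in> U - {u0}" for x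
      using that inj u0 by (auto dest: inj_onD)
    show "inj_on c (U - {u0})"
    proof (rule inj_onI)
      fix x x' assume x: "x \<in> U - {u0}" "x' \<in> U - {u0}" "c x = c x'"
      then have "fst x - fst u0 = fst x' - fst u0"
        using diff[OF x(1)] diff[OF x(2)] by (simp add: c_def field_simps)
      then show "x = x'" using x inj by (auto dest: inj_onD)
    qed
    show "N (z - c x) = snd x / (snd u0 * N (fst x - fst u0))" if z: "z \<in> g ` V" and x: "x \<in> U - {u0}" for z x
    proof -
      obtain y where y: "y \<in> V" "z = g y" using z by blast
      have "z - c x = (fst x + fst y) / ((fst u0 + fst y) * (fst x - fst u0))"
      proof -
        have "1 / a + 1 / b = (b + a) / (a * b)" if "a \<noteq> 0" "b \<noteq> 0" for a b :: 'a
          using that by (simp add: field_simps)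
        from this[OF sum_nz[OF u0 y(1)] diff[OF x]] show ?thesis
          by (simp add: y(2) g_def c_def)
      qed
      then have "N (z - c x) = (snd x * snd y) / (snd u0 * snd y * N (fst x - fst u0))"
        using UV[OF u0 y(1)] UV[of x y] x y(1) by (simp add: N_divide N_mult \<rho>_def)
      then show ?thesis using nz(1)[OF subsetD[OF V y(1)]] by simp
    qed
    show "finite (g ` V)" using finite_subset[OF V finite_Y] by simp
  qed (use finU U(2) u0 in auto)
  finally show ?thesis .
qed simp

text \<open>In the group with addition in the first and multiplication in the second component,
  \<open>reflect u x\<close> is the label \<open>(u, N u)\<close> minus \<open>x\<close>,
  \<open>translate u x\<close> is the label plus \<open>x\<close>, and \<open>opposite x\<close> is
  the inverse of \<open>x\<close>. They serve as \<open>\<alpha>\<close> and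
  \<open>\<gamma>\<close>, as \<open>\<beta>\<close>, and as \<open>\<iota>\<close>.\<close>

definition reflect :: "'a \<Rightarrow> 'a \<times> 'a \<Rightarrow> 'a \<times> 'a" where
  "reflect u x = (u - fst x, N u / snd x)"

definition translate :: "'a \<Rightarrow> 'a \<times> 'a \<Rightarrow> 'a \<times> 'a" where
  "translate u x = (u + fst x, N u * snd x)"

definition opposite :: "'a \<times> 'a \<Rightarrow> 'a \<times> 'a" where
  "opposite x = (- fst x, 1 / snd x)"

lemma bij_betw_reflect:
  assumes "u \<in> E" "u \<noteq> 0"
  shows "bij_betw (reflect u) Y Y"
  by (rule bij_betw_byWitness[where f' = "reflect u"])
     (use assms N_in_F in \<open>auto simp: reflect_def Y_def\<close>)

lemma bij_betw_translate:
  assumes "u \<in> E" "u \<noteq> 0"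
  shows "bij_betw (translate u) Y Y"
  by (rule bij_betw_byWitness[where f' = "\<lambda>x. (fst x - u, snd x / N u)"])
     (use assms N_in_F in \<open>auto simp: translate_def Y_def\<close>)

lemma bij_betw_opposite: "bij_betw opposite Y Y"
  by (rule bij_betw_byWitness[where f' = opposite]) (auto simp: opposite_def Y_def)

text \<open>In the group \<open>E \<times> F\<^sup>*\<close>, the pairs \<open>(u, N u)\<close> with \<open>u\<close> among these three satisfy \<open>b + c - a = (0, 1)\<close>.\<close>

definition lab_b :: "'a \<Rightarrow> 'a" where "lab_b w = w + 1"
definition lab_c :: "'a \<Rightarrow> 'a" where "lab_c w = 1 + 1 / w"
definition lab_a :: "'a \<Rightarrow> 'a" where "lab_a w = lab_b w * lab_c w"

text \<open>Sum and product of \<open>w + 1\<close> and \<open>1 + 1 / w\<close> are both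
  \<open>w + 2 + 1 / w\<close>. The sum serves the first components, the product the norms.\<close>

lemma lab_a_eq_sum: "w \<noteq> 0 \<Longrightarrow> lab_a w = lab_b w + lab_c w"
  by (simp add: lab_a_def lab_b_def lab_c_def field_simps)

text \<open>Supplies the locale condition \<open>\<gamma> w x = \<alpha> w (\<beta> w x)\<close>; in
  the group it reads \<open>c - x = a - (b + x)\<close>.\<close>

lemma reflect_lab_c:
  assumes "w \<noteq> 0" "w \<noteq> - 1"
  shows "reflect (lab_c w) x = reflect (lab_a w) (translate (lab_b w) x)"
proof -
  have "lab_b w \<noteq> 0" using assms(2) by (simp add: lab_b_def add_eq_0_iff2)
  then have "N (lab_b w) \<noteq> 0" by simp
  moreover have "N (lab_a w) = N (lab_b w) * N (lab_c w)" by (simp add: lab_a_def N_mult)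
  ultimately have "N (lab_c w) / snd x = N (lab_a w) / (N (lab_b w) * snd x)" by simp
  moreover have "lab_c w - fst x = lab_a w - (lab_b w + fst x)"
    using lab_a_eq_sum[OF assms(1)] by simp
  ultimately show ?thesis by (simp only: reflect_def translate_def fst_conv snd_conv)
qed

text \<open>Multiplied by \<open>w\<close>, the equation \<open>lab_a w = \<kappa>\<close> becomes a
  monic quadratic.\<close>

lemma card_lab_a_vimage: "card {w \<in> S - {0}. lab_a w = \<kappa>} \<le> 2"
proof -
  let ?p = "[:1, 2 - \<kappa>, 1:]"
  have "{w \<in> S - {0}. lab_a w = \<kappa>} \<subseteq> {w. poly ?p w = 0}"
  proof
    fix w assume "w \<in> {w \<in> S - {0}. lab_a w = \<kappa>}"
    then have "w \<noteq> 0" "\<kappa> = (w + 1) * (1 + 1 / w)" by (auto simp: lab_a_def lab_b_def lab_c_def)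
    then have "\<kappa> * w = (w + 1) * (w + 1)" by (simp add: distrib_right mult.assoc)
    then show "w \<in> {w. poly ?p w = 0}" by (simp add: algebra_simps)
  qed
  then have "card {w \<in> S - {0}. lab_a w = \<kappa>} \<le> card {w. poly ?p w = 0}"
    by (intro card_mono poly_roots_finite) auto
  also have "\<dots> \<le> Polynomial.degree ?p" by (intro card_poly_roots_bound) simp
  finally show ?thesis by simp
qed

text \<open>For fixed \<open>x\<close>, three of the conflicts in \<open>bad\<close> are quadratic
  in the other label and two determine it uniquely. So at most 8 labels conflict with
  \<open>x\<close>, and the greedy choice loses a factor 9. The summand 2 accounts for the excluded
  labels 0 and -1.\<close>

lemma exists_label_set:
  obtains W where "W \<subseteq> E - {0, - 1}" "inj_on lab_a W" "q ^ d \<le> 9 * card W + 2"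
    "\<And>w w'. w \<in> W \<Longrightarrow> w' \<in> W \<Longrightarrow> lab_a w \<noteq> lab_b w'"
    "\<And>w w'. w \<in> W \<Longrightarrow> w' \<in> W \<Longrightarrow> lab_a w \<noteq> lab_c w'"
proof -
  define S where "S = E - {0, - 1}"
  define bad where "bad w w' \<longleftrightarrow> lab_a w = lab_a w' \<or> lab_a w = lab_b w' \<or> lab_a w = lab_c w'
    \<or> lab_a w' = lab_b w \<or> lab_a w' = lab_c w" for w w'
  have S: "finite S" "S \<subseteq> UNIV - {0}" using finite_E by (auto simp: S_def)
  have "card {y\<in>S. bad x y} \<le> 8" for x
  proof -
    let ?R = "\<lambda>\<kappa>. {w \<in> S - {0}. lab_a w = \<kappa>}"
    have fin: "finite (?R \<kappa>)" for \<kappa> using S(1) by simp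
    have "{y\<in>S. bad x y} \<subseteq> ((?R (lab_a x) \<union> ?R (lab_b x)) \<union> ?R (lab_c x)) \<union> {lab_a x - 1, 1 / (lab_a x - 1)}"
      using S(2) by (auto simp: bad_def lab_b_def lab_c_def)
    then have "card {y\<in>S. bad x y} \<le> card (((?R (lab_a x) \<union> ?R (lab_b x)) \<union> ?R (lab_c x)) \<union> {lab_a x - 1, 1 / (lab_a x - 1)})"
      using fin by (intro card_mono) auto
    also have "\<dots> \<le> ((card (?R (lab_a x)) + card (?R (lab_b x))) + card (?R (lab_c x))) + card {lab_a x - 1, 1 / (lab_a x - 1)}"
      by (intro order.trans[OF card_Un_le] add_mono order.refl card_Un_le)
    also have "\<dots> \<le> ((2 + 2) + 2) + 2"
      using card_length[of "[lab_a x - 1, 1 / (lab_a x - 1)]"]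
      by (intro add_mono card_lab_a_vimage) simp_all
    finally show ?thesis by simp
  qed
  then have "\<exists>W\<subseteq>S. (\<forall>x\<in>W. \<forall>y\<in>W. x \<noteq> y \<longrightarrow> \<not> bad x y) \<and> card S \<le> (8 + 1) * card W"
    by (intro greedy_independent_set S(1)) (unfold bad_def, metis)
  then obtain W where W: "W \<subseteq> S" "\<forall>x\<in>W. \<forall>y\<in>W. x \<noteq> y \<longrightarrow> \<not> bad x y" "card S \<le> (8 + 1) * card W"
    by blast
  have "card E \<le> card (S \<union> {0, - 1})"
    using S(1) by (intro card_mono) (auto simp: S_def)
  also have "\<dots> \<le> card S + card {0, - 1 :: 'a}" by (rule card_Un_le)
  also have "card {0, - 1 :: 'a} \<le> 2" using card_length[of "[0, - 1 :: 'a]"] by simp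
  finally have card_W: "q ^ d \<le> 9 * card W + 2" using W(3) card_E by simp
  \<comment> \<open>Needed for \<open>w = w'\<close>: if \<open>lab_a w\<close> equalled one of its
    two summands, the other would be 0.\<close>
  have nz: "lab_b w \<noteq> 0" "lab_c w \<noteq> 0" "lab_a w = lab_b w + lab_c w" if "w \<in> W" for w
  proof -
    have w: "w \<noteq> 0" "w \<noteq> - 1" using that W(1) by (auto simp: S_def)
    then show "lab_b w \<noteq> 0" by (simp add: lab_b_def add_eq_0_iff2)
    then show "lab_c w \<noteq> 0" using w by (simp add: lab_b_def lab_c_def add_divide_eq_iff)
    show "lab_a w = lab_b w + lab_c w" using w by (intro lab_a_eq_sum)
  qed
  show thesis
  proof
    show "W \<subseteq> E - {0, - 1}" using W(1) by (simp add: S_def)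
    show "inj_on lab_a W" using W(2) by (auto simp: inj_on_def bad_def)
    show "lab_a w \<noteq> lab_b w'" if "w \<in> W" "w' \<in> W" for w w'
      using W(2) that nz[OF that(1)] by (cases "w = w'") (auto simp: bad_def)
    show "lab_a w \<noteq> lab_c w'" if "w \<in> W" "w' \<in> W" for w w'
      using W(2) that nz[OF that(1)] by (cases "w = w'") (auto simp: bad_def)
  qed (rule card_W)
qed

lemma bij_betw_map_prod_id: "bij_betw f A B \<Longrightarrow> bij_betw (map_prod f id) (A \<times> C) (B \<times> C)"
  by (auto simp: bij_betw_def map_prod_inj_on map_prod_surj_on)

text \<open>\<open>r\<close> disjoint copies give \<open>2 * r * card Y\<close> vertices and cloning
  supplies the remaining \<open>e < 2 * card Y\<close>. All degrees are \<open>2 * h\<close>, hence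
  there are \<open>n * h\<close> edges; the bound on \<open>q ^ d\<close> guarantees
  \<open>2 * h\<close> labels.\<close>

theorem rex_complete_bipartite_ge:
  assumes n: "2 * r * card Y \<le> n" "n < 2 * r * card Y + 2 * card Y" and r: "r > 0"
    and h: "9 * (2 * h) + 2 \<le> q ^ d" and t: "t > fact d" "t \<ge> 2"
  shows "n * h \<le> rex n (complete_bipartite (Suc d) t)"
proof -
  obtain W0 where W0: "W0 \<subseteq> E - {0, - 1}" "inj_on lab_a W0" "q ^ d \<le> 9 * card W0 + 2"
    "\<And>w w'. w \<in> W0 \<Longrightarrow> w' \<in> W0 \<Longrightarrow> lab_a w \<noteq> lab_b w'"
    "\<And>w w'. w \<in> W0 \<Longrightarrow> w' \<in> W0 \<Longrightarrow> lab_a w \<noteq> lab_c w'"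
    by (rule exists_label_set) (rule that)
  have "2 * h \<le> card W0" using h W0(3) by linarith
  then obtain W where W: "W \<subseteq> W0" "card W = 2 * h" "finite W"
    by (rule obtain_subset_with_card_n)
  have "h \<le> card W" using W(2) by simp
  then obtain W1 where W1: "W1 \<subseteq> W" "card W1 = h"
    by (rule obtain_subset_with_card_n)
  have nz: "w \<noteq> 0" "w \<noteq> - 1" "lab_b w \<noteq> 0" "lab_c w \<noteq> 0" "lab_a w \<noteq> 0"
    "lab_b w \<in> E" "lab_c w \<in> E" "lab_a w \<in> E" if "w \<in> W" for w
  proof -
    have w: "w \<noteq> 0" "w \<noteq> - 1" "w \<in> E" using that W(1) W0(1) by auto
    show "w \<noteq> 0" "w \<noteq> - 1" by (fact w)+
    show b: "lab_b w \<noteq> 0" using w by (simp add: lab_b_def add_eq_0_iff2)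
    then show c: "lab_c w \<noteq> 0" using w by (simp add: lab_b_def lab_c_def add_divide_eq_iff)
    show "lab_a w \<noteq> 0" using b c by (simp add: lab_a_def)
    show "lab_b w \<in> E" "lab_c w \<in> E" "lab_a w \<in> E"
      using w(3) by (simp_all add: lab_a_def lab_b_def lab_c_def)
  qed
  \<comment> \<open>\<open>r\<close> disjoint copies of the norm graph\<close>
  define \<Omega> where "\<Omega> = Y \<times> {..<r}"
  define e where "e = n - 2 * r * card Y"
  have card_\<Omega>: "card \<Omega> = r * card Y" by (simp add: \<Omega>_def card_cartesian_product mult.commute)
  have fin_\<Omega>: "finite \<Omega>" using finite_Y by (simp add: \<Omega>_def)
  \<comment> \<open>The number of clone pairs is half of \<open>e\<close>, rounded up; for odd
    \<open>e\<close> the set \<open>M\<close> has one element and its pair is merged.\<close>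
  have "(e + 1) div 2 \<le> card Y" using n by (simp add: e_def)
  also have "card Y \<le> card \<Omega>" using r by (simp add: card_\<Omega>)
  finally obtain Z where Z: "Z \<subseteq> \<Omega>" "card Z = (e + 1) div 2"
    by (rule obtain_subset_with_card_n)
  have "e mod 2 \<le> card Z" unfolding Z(2) by (cases e) (auto simp: mod_Suc, presburger?)
  then obtain M where M: "M \<subseteq> Z" "card M = e mod 2"
    by (rule obtain_subset_with_card_n)
  have e: "2 * card \<Omega> + 2 * card Z - card M = n"
  proof -
    have "2 * ((e + 1) div 2) = e + e mod 2" by presburger
    then show ?thesis using n(1) by (simp add: card_\<Omega> Z(2) M(2) e_def)
  qed
  interpret clone_surgery \<Omega> W W1 "\<lambda>w. map_prod (reflect (lab_a w)) id"
    "\<lambda>w. map_prod (translate (lab_b w)) id" "\<lambda>w. map_prod (reflect (lab_c w)) id" Z M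
  proof
    show "bij_betw (map_prod (reflect (lab_a w)) id) \<Omega> \<Omega>" if "w \<in> W" for w
      unfolding \<Omega>_def by (intro bij_betw_map_prod_id bij_betw_reflect nz that)
    show "bij_betw (map_prod (translate (lab_b w)) id) \<Omega> \<Omega>" if "w \<in> W" for w
      unfolding \<Omega>_def by (intro bij_betw_map_prod_id bij_betw_translate nz that)
    show "map_prod (reflect (lab_c w)) id x = map_prod (reflect (lab_a w)) id (map_prod (translate (lab_b w)) id x)"
      if "w \<in> W" for w x
      using reflect_lab_c[OF nz(1,2)[OF that]] by (cases x) simp
    show "inj_on (\<lambda>w. map_prod (reflect (lab_a w)) id x) W" for x
      using inj_on_subset[OF W0(2) W(1)] by (cases x) (auto simp: inj_on_def reflect_def)
    show "inj_on (\<lambda>w. map_prod (translate (lab_b w)) id x) W" for x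
      by (cases x) (auto simp: inj_on_def translate_def lab_b_def)
    show "inj_on (\<lambda>w. map_prod (reflect (lab_c w)) id x) W" for x
      using nz(1) by (cases x) (auto simp: inj_on_def reflect_def lab_c_def)
  qed (use fin_\<Omega> W W1 Z M in auto)
  \<comment> \<open>The relation on \<open>\<Omega>\<close> also demands equal copy indices, which
    confines a completely related pair of sets to one copy.\<close>
  have "(2 * card \<Omega> + 2 * card Z - card M) * card W
      \<le> 2 * rex (2 * card \<Omega> + 2 * card Z - card M) (complete_bipartite (Suc d) t)"
  proof (rule rex_clone_surgery_ge[where \<iota> = "map_prod opposite id"
        and \<rho> = "\<lambda>x y. snd x = snd y \<and> \<rho> (fst x) (fst y)"])
    have opp: "bij_betw (map_prod opposite id) \<Omega> \<Omega>"
      unfolding \<Omega>_def by (intro bij_betw_map_prod_id bij_betw_opposite)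
    then show "inj_on (map_prod opposite id) \<Omega>" by (rule bij_betw_imp_inj_on)
    show "map_prod opposite id x \<in> \<Omega>" if "x \<in> \<Omega>" for x
      using bij_betwE[OF opp] that by blast
    have snd_nz: "snd (fst x) \<noteq> 0" if "x \<in> \<Omega>" for x
      using that by (auto simp: \<Omega>_def Y_def)
    show "snd x = snd (map_prod (reflect (lab_a w)) id x) \<and> \<rho> (fst x) (fst (map_prod (reflect (lab_a w)) id x))"
      if "x \<in> \<Omega>" for w x
      using snd_nz[OF that] by (simp add: \<rho>_def reflect_def)
    show "snd x = snd (map_prod (reflect (lab_c w)) id x) \<and> \<rho> (fst x) (fst (map_prod (reflect (lab_c w)) id x))"
      if "x \<in> \<Omega>" for w x
      using snd_nz[OF that] by (simp add: \<rho>_def reflect_def)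
    show "snd (map_prod (translate (lab_b w)) id x) = snd (map_prod opposite id x) \<and>
        \<rho> (fst (map_prod (translate (lab_b w)) id x)) (fst (map_prod opposite id x))"
      if "x \<in> \<Omega>" for w x
      using snd_nz[OF that] by (simp add: \<rho>_def translate_def opposite_def)
    \<comment> \<open>Comparing first components, the two kinds of clash would require
      \<open>lab_a w = lab_c w'\<close> and \<open>lab_a w = lab_b w'\<close>, which the label set
      excludes.\<close>
    show "map_prod (reflect (lab_a w)) id x \<noteq> map_prod (reflect (lab_c w')) id x"
      if "w \<in> W" "w' \<in> W" for w w' x
      using W0(5)[OF subsetD[OF W(1) that(1)] subsetD[OF W(1) that(2)]] by (cases x) (auto simp: reflect_def)
    show "map_prod (reflect (lab_a w)) id (map_prod (translate (lab_b w')) id x) \<noteq> map_prod opposite id x"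
      if "w \<in> W" "w' \<in> W" for w w' x
      using W0(4)[OF subsetD[OF W(1) that(1)] subsetD[OF W(1) that(2)]] by (cases x) (auto simp: reflect_def translate_def opposite_def)
    show "snd y = snd x \<and> \<rho> (fst y) (fst x)" if "snd x = snd y \<and> \<rho> (fst x) (fst y)"
      for x y :: "('a \<times> 'a) \<times> nat"
      using that by (simp add: \<rho>_def add.commute mult.commute)
    show "\<exists>x\<in>U. \<exists>y\<in>V. \<not> (snd x = snd y \<and> \<rho> (fst x) (fst y))"
      if UV: "U \<subseteq> \<Omega>" "V \<subseteq> \<Omega>" "card U = Suc d" "card V = t" for U V
    proof (rule ccontr)
      assume no: "\<not> (\<exists>x\<in>U. \<exists>y\<in>V. \<not> (snd x = snd y \<and> \<rho> (fst x) (fst y)))"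
      have rel: "snd x = snd y \<and> \<rho> (fst x) (fst y)" if "x \<in> U" "y \<in> V" for x y
        using that no by blast
      have "U \<noteq> {}" "V \<noteq> {}" using UV(3,4) t by auto
      then obtain u v where uv: "u \<in> U" "v \<in> V" by blast
      have snd_eq: "snd x = snd u" if "x \<in> U \<union> V" for x
        using that rel[OF uv(1), of x] rel[OF _ uv(2), of x] rel[OF uv] by auto
      have inj: "inj_on fst (U \<union> V)"
      proof (rule inj_onI)
        fix x y assume "x \<in> U \<union> V" "y \<in> U \<union> V" "fst x = fst y"
        then show "x = y" using snd_eq[of x] snd_eq[of y] by (simp add: prod_eq_iff)
      qed
      have "card (fst ` V) \<le> fact d"
      proof (rule card_common_neighbours_le)
        show "fst ` U \<subseteq> Y" "fst ` V \<subseteq> Y" using UV(1,2) by (auto simp: \<Omega>_def)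
        show "card (fst ` U) = Suc d"
          using UV(3) inj_on_subset[OF inj, of U] by (simp add: card_image)
        show "\<rho> x y" if "x \<in> fst ` U" "y \<in> fst ` V" for x y
          using that rel by blast
      qed
      then show False using UV(4) t inj_on_subset[OF inj, of V] by (simp add: card_image)
    qed
  qed (use M(2) t d in auto)
  then show ?thesis unfolding e W(2) by simp
qed

end

subsection \<open>The lower bound\<close>

text \<open>The algebraic closure of \<open>gf2\<close> serves as the ambient field; its
  characteristic is carried along as an abstract prime.\<close>

lemma prime_CHAR_gf2_closure: "normalization_semidom_class.prime CHAR(gf2 alg_closure)"
proof -
  have "CHAR(gf2) > 0" by (rule finite_imp_CHAR_pos) simp
  then have "normalization_semidom_class.prime CHAR(gf2)" by (rule prime_CHAR_semidom)
  then show ?thesis by simp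
qed

text \<open>Choose \<open>j\<close> with \<open>B ^ j \<le> n div 2 < B ^ (j + 1)\<close> and let
  \<open>q\<close> be the \<open>j\<close>-th power of the characteristic, so
  \<open>B ^ j = q ^ s\<close>. Then \<open>n \<le> 2 * B * q ^ s\<close>, so \<open>n\<close> to
  the power \<open>1 - 1 / s\<close> is at most \<open>2 * B * q ^ d\<close>; together with
  \<open>q ^ d \<le> 40 * h\<close> this gives the constant \<open>80 * B\<close>.\<close>

lemma rex_complete_bipartite_lower_bound:
  fixes s t n :: nat
  defines "B \<equiv> CHAR(gf2 alg_closure) ^ s"
  assumes s: "s \<ge> 3" and t: "t > fact s" and n: "n \<ge> 2 * B ^ 5"
  shows "real n powr (2 - 1 / real s) / (80 * real B) \<le> real (rex n (complete_bipartite s t))"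
proof -
  define p where "p = CHAR(gf2 alg_closure)"
  define d where "d = s - 1"
  have sd: "s = Suc d" "d \<ge> 2" using s by (simp_all add: d_def)
  have p2: "p \<ge> 2" unfolding p_def by (rule prime_ge_2_nat[OF prime_CHAR_gf2_closure])
  have B: "B = p ^ s" by (simp add: B_def p_def)
  have B2: "B \<ge> 2"
  proof -
    have "p ^ 1 \<le> p ^ s" using p2 s by (intro power_increasing) auto
    then show ?thesis using p2 B by simp
  qed
  have m: "B ^ 5 \<le> n div 2" using n by simp
  moreover have "1 \<le> B ^ 5" using B2 by simp
  ultimately obtain j where j: "B ^ j \<le> n div 2" "n div 2 < B ^ (j + 1)"
    using ex_power_ivl1[OF B2, of "n div 2"] by force
  have "B ^ 5 < B ^ (j + 1)" using m j(2) by linarith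
  then have j5: "5 \<le> j" using power_less_imp_less_exp[of B 5 "j + 1"] B2 by simp
  define q where "q = p ^ j"
  have Bj: "B ^ j = q ^ s" by (simp add: B q_def mult.commute flip: power_mult)
  interpret norm_graph q d "TYPE(gf2 alg_closure)"
  proof
    show "normalization_semidom_class.prime CHAR(gf2 alg_closure)" by (rule prime_CHAR_gf2_closure)
    show "\<exists>j>0. q = CHAR(gf2 alg_closure) ^ j"
      using j5 by (intro exI[of _ j]) (simp add: q_def p_def)
    show "d > 0" using sd by simp
  qed
  have "2 ^ 5 \<le> q"
  proof -
    have "(2::nat) ^ 5 \<le> p ^ 5" using p2 by (intro power_mono) auto
    also have "\<dots> \<le> p ^ j" using p2 j5 by (intro power_increasing) auto
    finally show ?thesis by (simp add: q_def)
  qed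
  then have q: "32 \<le> q" by simp
  have "q ^ 1 \<le> q ^ d" using q sd by (intro power_increasing) auto
  then have qd: "32 \<le> q ^ d" using q by simp
  \<comment> \<open>\<open>n \<ge> 2 * B ^ 5\<close> forces \<open>j \<ge> 5\<close> and
    \<open>q \<ge> 32\<close>, so \<open>h \<ge> 1\<close>. Dividing by 20 leaves room for the
    summand 2 in \<open>18 * h + 2 \<le> q ^ d\<close>, and rounding down costs at most a factor
    2.\<close>
  define h where "h = q ^ d div 20"
  have "20 * h \<le> q ^ d" "q ^ d < 20 * h + 20"
    using div_times_less_eq_dividend[of "q ^ d" 20] dividend_less_div_times[of 20 "q ^ d"]
    by (simp_all add: h_def mult.commute)
  moreover from this have "1 \<le> h" using qd by linarith
  ultimately have h: "9 * (2 * h) + 2 \<le> q ^ d" "q ^ d \<le> 40 * h" by linarith+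
  define r where "r = n div (2 * card Y)"
  have cY: "0 < card Y" using q by (simp add: card_Y)
  have "card Y \<le> q ^ d * q" unfolding card_Y by (intro mult_le_mono) simp_all
  also have "\<dots> = q ^ s" by (simp add: sd(1) mult.commute)
  finally have "card Y \<le> q ^ s" .
  then have "2 * card Y \<le> n" using j(1) Bj by linarith
  then have r: "r > 0" using cY by (simp add: r_def div_greater_zero_iff)
  have "n * h \<le> rex n (complete_bipartite (Suc d) t)"
  proof (rule rex_complete_bipartite_ge[of r])
    show "2 * r * card Y \<le> n"
      using div_times_less_eq_dividend[of n "2 * card Y"] by (simp add: r_def mult_ac)
    show "n < 2 * r * card Y + 2 * card Y"
      using dividend_less_div_times[of "2 * card Y" n] cY by (simp add: r_def mult_ac)
    have "fact d \<le> (fact s :: nat)" using sd by (intro fact_mono) simp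
    then show "t > fact d" using t by linarith
    have "(1::nat) \<le> fact s" by simp
    then show "t \<ge> 2" using t by linarith
  qed (use r h in auto)
  then have rex: "real n * real h \<le> real (rex n (complete_bipartite s t))"
    unfolding sd(1) by (metis of_nat_le_iff of_nat_mult)
  have n0: "0 < n" using \<open>2 * card Y \<le> n\<close> cY by linarith
  have s0: "0 < real s" using s by simp
  have "n \<le> 2 * B * B ^ j" using j(2) by simp
  then have "real n \<le> 2 * real B * real (q ^ s)" unfolding Bj by (metis of_nat_le_iff of_nat_mult of_nat_numeral)
  then have "real n powr (1 - 1 / real s) \<le> (2 * real B * real (q ^ s)) powr (1 - 1 / real s)"
    using s by (intro powr_mono2) auto
  also have "\<dots> = (2 * real B) powr (1 - 1 / real s) * real (q ^ s) powr (1 - 1 / real s)"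
    by (simp add: powr_mult)
  \<comment> \<open>The exponent of \<open>2 * B\<close> is rounded up to 1 to keep the constant
    simple.\<close>
  also have "\<dots> \<le> (2 * real B) powr 1 * real (q ^ s) powr (1 - 1 / real s)"
    using B2 s by (intro mult_right_mono powr_mono) auto
  also have "real (q ^ s) powr (1 - 1 / real s) = real (q ^ d)"
  proof -
    have "real (q ^ s) powr (1 - 1 / real s) = real q powr (real s * (1 - 1 / real s))"
      using q by (simp add: powr_powr flip: powr_realpow)
    also have "real s * (1 - 1 / real s) = real d"
    proof -
      have "real s * (1 - 1 / real s) = real s - 1" using s0 by (simp add: right_diff_distrib)
      then show ?thesis using sd(1) by simp
    qed
    also have "real q powr real d = real (q ^ d)"
      using q by (simp add: powr_realpow)
    finally show ?thesis .
  qed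
  also have "(2 * real B) powr 1 * real (q ^ d) \<le> (2 * real B) powr 1 * (40 * real h)"
  proof (rule mult_left_mono)
    show "real (q ^ d) \<le> 40 * real h" using h(2) by linarith
  qed simp
  finally have "real n powr (1 - 1 / real s) \<le> 80 * real B * real h"
    using B2 by simp
  then have "real n * real n powr (1 - 1 / real s) \<le> real n * (80 * real B * real h)"
    by (rule mult_left_mono) simp
  also have "real n * real n powr (1 - 1 / real s) = real n powr (2 - 1 / real s)"
    using n0 powr_mult_base[of "real n" "1 - 1 / real s"] by simp
  finally have "real n powr (2 - 1 / real s) / (80 * real B) \<le> real n * real h"
    using B2 by (simp add: divide_le_eq mult_ac)
  then show ?thesis using rex by linarith
qed

text \<open>\<open>B\<close> is determined by \<open>s\<close>, so the constant is fixed before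
  \<open>t\<close>; the threshold \<open>2 * B ^ 5\<close> does not depend on \<open>t\<close>
  either.\<close>

theorem theorem1p4:
  fixes s :: nat
  assumes "s \<ge> 3"
  shows "\<exists>C::real. C > 0 \<and> (\<forall>t::nat. t > fact s \<longrightarrow>
           (\<forall>\<^sub>F n in sequentially.
              real (rex n (complete_bipartite s t)) \<ge> C * real n powr (2 - 1 / real s)))"
proof -
  define B where "B = CHAR(gf2 alg_closure) ^ s"
  have "B > 0"
    using prime_gt_0_nat[OF prime_CHAR_gf2_closure] by (simp add: B_def)
  have "\<forall>\<^sub>F n in sequentially.
      real (rex n (complete_bipartite s t)) \<ge> 1 / (80 * real B) * real n powr (2 - 1 / real s)"
    if "t > fact s" for t
    using eventually_ge_at_top[of "2 * B ^ 5"]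
  proof eventually_elim
    case (elim n)
    then show ?case
      using rex_complete_bipartite_lower_bound[OF assms that, of n] by (simp add: B_def)
  qed
  then show ?thesis
    using \<open>B > 0\<close> by (intro exI[of _ "1 / (80 * real B)"]) simp
qed

end
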